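(* Let $G$ be a connected graph with $n$ vertices such that $M=M^*(G)$ is simple (equivalently, $G$ has no bridge and no $2$-edge bond), and suppose $|E(M)|=2(r(M)-1)$ (so $r(M)=n+1$ and $|E(G)|=2n$). Let $c:E(G)\to[n]$ be a colouring in which every colour class has exactly two edges, and suppose $(M,c)$ is circuit-achromatic (no bond of $G$ is rainbow). Let $G\xrightarrow[v^1]{e^1}G^1\xrightarrow[v^2]{e^2}G^2\xrightarrow[v^3]{e^3}G^3$ be a sequence of splittings such that $T=\{e^1,e^2,e^3\}$ is a circuit of $M^*(G^3)$ (a bond of $G^3$) which is independent in $M(G^3)$. Extend $c$ to $G^3$ by $c(e^i)=n+1$ for $i=1,2,3$. Then $G^3$ contains two edge-disjoint rainbow cocycles $C_1,C_2$ with $e^i\in C_i$ for $i=1,2$ and $|C_1|+|C_2|\le r(M)+2=n+3$.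
   Context: Splitting: for a graph $H$ and a vertex $v$, partition the set of edges incident with $v$ into two nonempty sets $E_1,E_2$; the graph $H'$ is obtained by replacing $v$ by two new vertices $v_1,v_2$, making each edge of $E_i$ incident with $v_i$ instead of $v$ (other ends unchanged), and adding a new edge $f$ with ends $v_1,v_2$; this is written $H\xrightarrow[v]{f}H'$ (so $H'/f=H$). $M(H)$ is the cycle matroid and $M^*(H)$ the cocycle (bond) matroid of $H$. A cocycle of a graph is a nonempty edge cut, i.e. a set of edges with exactly one end in $X$ for some $X\subseteq V$. A set of edges is rainbow if its edges have pairwise distinct colours; $(M,c)$ is circuit-achromatic if $M$ has no rainbow circuit.
   Formalization: The claim "e^i in C_i for i=1,2" fails for a prescribed labelling (e.g. G two vertices with four parallel edges), so it is proved up to relabelling T: C_1 and C_2 contain two distinct edges of T, not necessarily e^1 and e^2. *)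

theory Defs
  imports Main
begin

(* Graphs are finite and undirected; loops and parallel edges are allowed, so edges have an
   identity of their own. The set of ends of an edge is a singleton exactly for a loop. *)

record ('v, 'e) mgraph =
  verts :: "'v set"
  edges :: "'e set"
  ends :: "'e \<Rightarrow> 'v set"

definition graph :: "('v, 'e) mgraph \<Rightarrow> bool" where
  "graph G \<longleftrightarrow> finite (verts G) \<and> finite (edges G) \<and>
     (\<forall>e\<in>edges G. ends G e \<subseteq> verts G \<and> card (ends G e) \<in> {1, 2})"

definition connected_graph :: "('v, 'e) mgraph \<Rightarrow> bool" where
  "connected_graph G \<longleftrightarrow> verts G \<noteq> {} \<and>
     (\<forall>u\<in>verts G. \<forall>w\<in>verts G. (u, w) \<in> {(x, y). \<exists>e\<in>edges G. ends G e = {x, y}}\<^sup>*)"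

(* A loop is a cycle with one vertex, a pair of parallel edges is a cycle with two. *)

definition is_cycle :: "('v, 'e) mgraph \<Rightarrow> 'e set \<Rightarrow> bool" where
  "is_cycle G C \<longleftrightarrow> (\<exists>vs es. es \<noteq> [] \<and> length vs = length es \<and> distinct vs \<and> distinct es \<and>
     set vs \<subseteq> verts G \<and> set es \<subseteq> edges G \<and>
     (\<forall>i<length es. ends G (es ! i) = {vs ! i, vs ! (Suc i mod length es)}) \<and> C = set es)"

(* The second conjunct says "exactly one end in X"; a loop never qualifies. *)

definition cocycle :: "('v, 'e) mgraph \<Rightarrow> 'e set \<Rightarrow> bool" where
  "cocycle G C \<longleftrightarrow> C \<noteq> {} \<and>
     (\<exists>X\<subseteq>verts G. C = {e\<in>edges G. ends G e \<inter> X \<noteq> {} \<and> ends G e - X \<noteq> {}})"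

(* splitting H v f H' is the relation written as an arrow from H to H' with v below and f above.
   It is E1, E2 that partition the edges at v, so a loop at v in Ei becomes a loop at vi. *)

definition splitting :: "('v, 'e) mgraph \<Rightarrow> 'v \<Rightarrow> 'e \<Rightarrow> ('v, 'e) mgraph \<Rightarrow> bool" where
  "splitting H v f H' \<longleftrightarrow> v \<in> verts H \<and> f \<notin> edges H \<and>
     (\<exists>E1 E2 v1 v2. E1 \<noteq> {} \<and> E2 \<noteq> {} \<and> E1 \<inter> E2 = {} \<and>
        E1 \<union> E2 = {e\<in>edges H. v \<in> ends H e} \<and>
        v1 \<notin> verts H \<and> v2 \<notin> verts H \<and> v1 \<noteq> v2 \<and>
        verts H' = (verts H - {v}) \<union> {v1, v2} \<and>
        edges H' = insert f (edges H) \<and>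
        ends H' f = {v1, v2} \<and>
        (\<forall>e\<in>E1. ends H' e = (ends H e - {v}) \<union> {v1}) \<and>
        (\<forall>e\<in>E2. ends H' e = (ends H e - {v}) \<union> {v2}) \<and>
        (\<forall>e\<in>edges H - (E1 \<union> E2). ends H' e = ends H e))"

(* Only the data of a matroid; the notions below are applied to the matroids of finite graphs. *)

record 'e matroid =
  ground :: "'e set"
  indep :: "'e set \<Rightarrow> bool"

definition circuit :: "'e matroid \<Rightarrow> 'e set \<Rightarrow> bool" where
  "circuit M C \<longleftrightarrow> C \<subseteq> ground M \<and> \<not> indep M C \<and> (\<forall>D. D \<subset> C \<longrightarrow> indep M D)"

definition basis :: "'e matroid \<Rightarrow> 'e set \<Rightarrow> bool" where
  "basis M B \<longleftrightarrow> indep M B \<and> (\<forall>I. indep M I \<and> B \<subseteq> I \<longrightarrow> I = B)"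

definition rank :: "'e matroid \<Rightarrow> nat" where
  "rank M = Max (card ` {I. indep M I})"

definition dual :: "'e matroid \<Rightarrow> 'e matroid" where
  "dual M = \<lparr>ground = ground M, indep = (\<lambda>I. I \<subseteq> ground M \<and> (\<exists>B. basis M B \<and> I \<inter> B = {}))\<rparr>"

definition simple_matroid :: "'e matroid \<Rightarrow> bool" where
  "simple_matroid M \<longleftrightarrow> \<not> (\<exists>C. circuit M C \<and> card C \<in> {1, 2})"

definition cycle_matroid :: "('v, 'e) mgraph \<Rightarrow> 'e matroid" where
  "cycle_matroid G =
     \<lparr>ground = edges G, indep = (\<lambda>F. F \<subseteq> edges G \<and> \<not> (\<exists>C. is_cycle G C \<and> C \<subseteq> F))\<rparr>"

definition cocycle_matroid :: "('v, 'e) mgraph \<Rightarrow> 'e matroid" where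
  "cocycle_matroid G = dual (cycle_matroid G)"

definition rainbow :: "('e \<Rightarrow> 'c) \<Rightarrow> 'e set \<Rightarrow> bool" where
  "rainbow c S \<longleftrightarrow> inj_on c S"

definition circuit_achromatic :: "'e matroid \<Rightarrow> ('e \<Rightarrow> 'c) \<Rightarrow> bool" where
  "circuit_achromatic M c \<longleftrightarrow> \<not> (\<exists>C. circuit M C \<and> rainbow c C)"

(* Labelling of T. Up to isomorphism, every order of e1, e2, e3 yields the same G3, so the claim
   "e^i is in C_i for i = 1, 2" can only hold up to the labelling of T = {e1, e2, e3}. For a
   prescribed labelling it fails: let G have two vertices and four parallel edges, p, q of
   colour 1 and r, s of colour 2, and let G3 have vertices 0, ..., 4 with
     p = q = 34, r = 02, s = 01, e1 = 14, e2 = 03, e3 = 24   (ends).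
   Let a cut with 0 in X and 3 not in X (so containing e2) be rainbow. Then 4 is not in X because
   of p, q; 1 and 2 are not in X because e1, e3 share the colour of e2; hence it contains both
   r and s, a contradiction. The labelling e1, e3 works here: {e1, s} and {e3, r}.
   Hence the conclusion uses a relabelling f1, f2, f3 of T. *)

end

theory Submission
  imports Defs
begin

text \<open>
  Only the edges of $G_3$ outside $T$ and the $n + 3$ vertices of $G_3$ matter. A colour class that
  is a pair of parallel edges of $G_3$ can be contracted: this lowers both the number of colours and
  the number of vertices by one, and cuts of the contraction are cuts of $G_3$. So assume there is no
  such class. Then a colour can make the star of at most one vertex non-rainbow, and the set $N$ of
  the vertices whose star is rainbow outside $T$ has at least three elements. Each of them is an end
  of an edge of $T$, because $G = G_3 / T$ has no rainbow cut. As $T$ is itself a cut, the star of a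
  vertex of $N$ extends to a cut by exactly one edge of $T$, namely its only $T$-edge or, if it has
  two of them, the third one. Two vertices of $N$ with disjoint stars and different such edges give
  the required cuts if their degrees outside $T$ sum to at most $n + 1$. Since vertices off $T$ have
  degree at least three, and the other vertices outside $N$ at least two, degree counting bounds the
  degrees on $N$. A case analysis on the shape of the forest $T$ (star, path, cherry plus edge,
  matching) then finishes the proof.
\<close>

section \<open>Cuts and contractions\<close>

text \<open>The bound n + 1 is n + 3 less the two added edges of \<open>T\<close>. If the wanted
  cuts do not exist, every admissible pair in \<open>N\<close> has degree sum at least n + 2, while
  counting bounds the degree sum over \<open>N\<close> by n + 2 |N| + |VT| - 9, where
  \<open>VT\<close> is the set of ends of \<open>T\<close>. The obstacle is that this is not yet a
  contradiction: two vertices completed by the same edge of \<open>T\<close>, or two on one side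
  with a common edge, form no admissible pair, and some cases miss by one. The colours close the
  gap. Giving each vertex outside \<open>N\<close> a colour class inside its star uses n + 3 - |N|
  different colours and leaves |N| - 3 over. If |N| = 3, every class sits at a vertex outside
  \<open>N\<close>, so no edge joins two vertices of \<open>N\<close> and no colour occurs on both
  sides of \<open>T\<close>. If |N| = 4, one exceptional colour remains, with only two edges, too
  few for the tight configurations. Contraction might turn \<open>T\<close> into a multigraph with a
  digon; this is excluded from cut conditions that survive contraction.\<close>

definition edge_cut :: "('v, 'e) mgraph \<Rightarrow> 'v set \<Rightarrow> 'e set" where
  "edge_cut G X = {e\<in>edges G. ends G e \<inter> X \<noteq> {} \<and> ends G e - X \<noteq> {}}"

lemma cut_subset: "edge_cut G X \<subseteq> edges G"
  by (auto simp: edge_cut_def)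

lemma graph_ends:
  assumes "graph G" "e \<in> edges G"
  obtains x y where "ends G e = {x, y}" "x \<in> verts G" "y \<in> verts G"
proof -
  have "ends G e \<subseteq> verts G" "card (ends G e) = 1 \<or> card (ends G e) = 2"
    using assms by (auto simp: graph_def)
  then show thesis
    by (metis card_1_singletonE card_2_iff insert_absorb2 insert_subset that)
qed

lemma cut_iff:
  assumes "e \<in> edges G" "ends G e = {x, y}"
  shows "e \<in> edge_cut G X \<longleftrightarrow> (x \<in> X) \<noteq> (y \<in> X)"
  using assms by (auto simp: edge_cut_def)

text \<open>Crossing a cut is a parity condition on the two ends, so cuts add modulo 2. This serves
  to complement a cut inside \<open>T\<close>, to cancel a common edge of \<open>T\<close>, and to
  identify the sides of a bond.\<close>

lemma cut_symdiff_iff: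
  assumes "graph G" "e \<in> edges G"
  shows "e \<in> edge_cut G ((X - Y) \<union> (Y - X)) \<longleftrightarrow> (e \<in> edge_cut G X) \<noteq> (e \<in> edge_cut G Y)"
proof -
  obtain x y where "ends G e = {x, y}" using graph_ends[OF assms] by metis
  then show ?thesis using cut_iff[OF assms(2)] by auto
qed

lemma finite_cut: "graph G \<Longrightarrow> finite (edge_cut G X)"
  by (rule finite_subset[OF cut_subset]) (simp add: graph_def)

text \<open>Loops are left out because they cross no cut; \<open>F\<close> is a parameter because
  stars are also taken without \<open>T\<close>.\<close>

definition edge_star :: "('v, 'e) mgraph \<Rightarrow> 'e set \<Rightarrow> 'v \<Rightarrow> 'e set" where
  "edge_star G F v = {e\<in>F. v \<in> ends G e \<and> card (ends G e) = 2}"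

lemma cut_singleton:
  assumes "graph G"
  shows "edge_cut G {v} = edge_star G (edges G) v"
proof (rule set_eqI)
  fix e
  show "e \<in> edge_cut G {v} \<longleftrightarrow> e \<in> edge_star G (edges G) v"
  proof (cases "e \<in> edges G")
    case True
    obtain x y where "ends G e = {x, y}" using graph_ends[OF assms True] by metis
    then show ?thesis using True by (auto simp: edge_cut_def edge_star_def card_insert_if)
  qed (auto simp: edge_cut_def edge_star_def)
qed

text \<open>Meant as the contraction of the edges outside \<open>F\<close>, with
  \<open>\<phi>\<close> constant on the ends of each of them. Edges of \<open>F\<close> may become
  loops, which no cut sees.\<close>

definition quotient_graph :: "('v, 'e) mgraph \<Rightarrow> ('v \<Rightarrow> 'v) \<Rightarrow> 'e set \<Rightarrow> ('v, 'e) mgraph" where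
  "quotient_graph G \<phi> F = \<lparr>verts = \<phi> ` verts G, edges = F, ends = (\<lambda>e. \<phi> ` ends G e)\<rparr>"

lemma quotient_simps [simp]:
  "verts (quotient_graph G \<phi> F) = \<phi> ` verts G"
  "edges (quotient_graph G \<phi> F) = F"
  "ends (quotient_graph G \<phi> F) e = \<phi> ` ends G e"
  by (simp_all add: quotient_graph_def)

lemma graph_quotient:
  assumes "graph G" "F \<subseteq> edges G"
  shows "graph (quotient_graph G \<phi> F)"
proof -
  have "\<phi> ` ends G e \<subseteq> \<phi> ` verts G \<and> card (\<phi> ` ends G e) \<in> {1, 2}" if eF: "e \<in> F" for e
  proof -
    obtain x y where "ends G e = {x, y}" "x \<in> verts G" "y \<in> verts G"
      using graph_ends[OF assms(1)] eF assms(2) by blast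
    then show ?thesis by (auto simp: card_insert_if)
  qed
  then show ?thesis using assms finite_subset by (auto simp: graph_def)
qed

text \<open>A contracted edge has both ends in the same fibre, so it never crosses a preimage. Since
  the two cuts are equal as edge sets, size, colours and intersections carry over unchanged.\<close>

lemma cut_quotient:
  assumes "graph G" "F \<subseteq> edges G"
    and "\<And>e x y. e \<in> edges G - F \<Longrightarrow> x \<in> ends G e \<Longrightarrow> y \<in> ends G e \<Longrightarrow> \<phi> x = \<phi> y"
  shows "edge_cut (quotient_graph G \<phi> F) X = edge_cut G {v\<in>verts G. \<phi> v \<in> X}"
proof (rule set_eqI)
  fix e
  show "e \<in> edge_cut (quotient_graph G \<phi> F) X \<longleftrightarrow> e \<in> edge_cut G {v\<in>verts G. \<phi> v \<in> X}"
  proof (cases "e \<in> edges G")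
    case True
    obtain x y where xy: "ends G e = {x, y}" "x \<in> verts G" "y \<in> verts G"
      using graph_ends[OF assms(1) True] by metis
    show ?thesis
    proof (cases "e \<in> F")
      case True
      then show ?thesis using xy assms(2) by (auto simp: edge_cut_def)
    next
      case False
      then have "\<phi> x = \<phi> y" using assms(3)[of e x y] True xy by auto
      then show ?thesis using xy False by (auto simp: edge_cut_def)
    qed
  next
    case False
    then show ?thesis using assms(2) by (auto simp: edge_cut_def)
  qed
qed

lemma quotient_preimage_trivial:
  assumes "X \<subseteq> \<phi> ` V"
  shows "{v\<in>V. \<phi> v \<in> X} = {} \<longleftrightarrow> X = {}" "{v\<in>V. \<phi> v \<in> X} = V \<longleftrightarrow> X = \<phi> ` V"
  using assms by auto

text \<open>Only genuine parallel pairs are excluded. Equally coloured loops at one vertex are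
  harmless, since they lie in no star.\<close>

definition parallel_free :: "('v, 'e) mgraph \<Rightarrow> 'e set \<Rightarrow> ('e \<Rightarrow> 'c) \<Rightarrow> bool" where
  "parallel_free G F c \<longleftrightarrow> (\<forall>e\<in>F. \<forall>f\<in>F. e \<noteq> f \<and> c e = c f \<and> ends G e = ends G f \<longrightarrow>
     card (ends G e) \<noteq> 2)"

lemma card_2_superset_eq: "card S = 2 \<Longrightarrow> v \<in> S \<Longrightarrow> w \<in> S \<Longrightarrow> v \<noteq> w \<Longrightarrow> S = {v, w}"
  by (auto simp: card_2_iff)

text \<open>A repeated colour in a star brings its whole class into the star, as classes have at
  most two edges. A class lying in the stars of two vertices would be a parallel pair, so choosing
  one such colour per vertex is injective.\<close>

lemma nonrainbow_stars_injection:
  assumes "finite F" and cl: "\<And>e. e \<in> F \<Longrightarrow> card {f\<in>F. c f = c e} \<le> 2"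
    and pf: "parallel_free G F c" and Z: "\<And>v. v \<in> Z \<Longrightarrow> \<not> inj_on c (edge_star G F v)"
  obtains g where "inj_on g Z" "g ` Z \<subseteq> c ` F" "\<forall>v\<in>Z. {f\<in>F. c f = g v} \<subseteq> edge_star G F v"
proof -
  have "\<forall>v\<in>Z. \<exists>k e f. e \<in> F \<and> f \<in> F \<and> e \<noteq> f \<and> c e = k \<and> c f = k \<and> {h\<in>F. c h = k} \<subseteq> edge_star G F v"
  proof
    fix v assume "v \<in> Z"
    then obtain e f where ef: "e \<in> edge_star G F v" "f \<in> edge_star G F v" "c e = c f" "e \<noteq> f"
      using Z[of v] by (auto simp: inj_on_def)
    then have F: "e \<in> F" "f \<in> F" by (auto simp: edge_star_def)
    have "{h\<in>F. c h = c e} = {e, f}"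
      using card_seteq[of "{h\<in>F. c h = c e}" "{e, f}"] cl[OF F(1)] assms(1) F ef by auto
    then show "\<exists>k e f. e \<in> F \<and> f \<in> F \<and> e \<noteq> f \<and> c e = k \<and> c f = k \<and> {h\<in>F. c h = k} \<subseteq> edge_star G F v"
      using ef F by (intro exI[of _ "c e"] exI[of _ e] exI[of _ f]) auto
  qed
  then obtain g where g: "\<forall>v\<in>Z. \<exists>e f. e \<in> F \<and> f \<in> F \<and> e \<noteq> f \<and> c e = g v \<and> c f = g v
      \<and> {h\<in>F. c h = g v} \<subseteq> edge_star G F v"
    unfolding bchoice_iff by blast
  have "inj_on g Z"
  proof (rule inj_onI, rule ccontr)
    fix v w assume vw: "v \<in> Z" "w \<in> Z" "g v = g w" "v \<noteq> w"
    obtain e f where ef: "e \<in> F" "f \<in> F" "e \<noteq> f" "c e = g v" "c f = g v"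
      "{h\<in>F. c h = g v} \<subseteq> edge_star G F v" using g vw(1) by blast
    have "{h\<in>F. c h = g v} \<subseteq> edge_star G F w" using g vw(2,3) by auto
    then have "e \<in> edge_star G F v" "f \<in> edge_star G F v" "e \<in> edge_star G F w" "f \<in> edge_star G F w" using ef by auto
    then have "ends G e = {v, w}" "ends G f = {v, w}"
      using vw(4) by (simp_all add: edge_star_def card_2_superset_eq)
    moreover from this have "card (ends G e) = 2" using vw(4) by simp
    ultimately show False using pf ef(1-5) unfolding parallel_free_def by metis
  qed
  moreover have "g ` Z \<subseteq> c ` F" using g by (metis (no_types, lifting) image_eqI image_subsetI)
  moreover have "\<forall>v\<in>Z. {f\<in>F. c f = g v} \<subseteq> edge_star G F v"
    using g by (intro ballI) (drule (1) bspec, elim exE conjE)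
  ultimately show thesis by (rule that)
qed

text \<open>
  The alternative of a small cut is needed: if every edge of a tree is doubled by an edge of the same
  colour, then no cut is rainbow.
\<close>

lemma exists_small_or_rainbow_cut:
  assumes "graph G" and "\<And>e. e \<in> edges G \<Longrightarrow> card {f\<in>edges G. c f = c e} \<le> 2"
    and "card (c ` edges G) < card (verts G)" and "2 \<le> card (verts G)"
  shows "\<exists>X\<subseteq>verts G. X \<noteq> {} \<and> X \<noteq> verts G \<and> (card (edge_cut G X) \<le> 2 \<or> inj_on c (edge_cut G X))"
  using assms
proof (induction "card (verts G)" arbitrary: G rule: less_induct)
  case less
  note g = less.prems(1) and cl = less.prems(2) and lt = less.prems(3) and two = less.prems(4)
  have fin: "finite (verts G)" "finite (edges G)" using g by (auto simp: graph_def)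
  have proper: "{v} \<noteq> verts G" for v
  proof
    assume "{v} = verts G"
    then have "card (verts G) = card {v}" by (rule arg_cong[OF sym])
    then show False using two by simp
  qed
  show ?case
  proof (cases "card (verts G) = 2")
    case True
    then have le1: "card (c ` edges G) \<le> 1" using lt by simp
    \<comment> \<open>Two vertices leave room for at most one colour, hence at most two edges, and
      every cut is small.\<close>
    have "card (edges G) \<le> 2"
    proof (cases "edges G = {}")
      case False
      then obtain e where e: "e \<in> edges G" by blast
      have "{c e} = c ` edges G" by (rule card_seteq) (use fin(2) e le1 in simp_all)
      then have "{f\<in>edges G. c f = c e} = edges G" by blast
      then show ?thesis using cl[OF e] by simp
    qed auto
    then have le2: "card (edge_cut G X) \<le> 2" for X
      by (rule le_trans[OF card_mono[OF fin(2) cut_subset]])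
    obtain v where "v \<in> verts G" using two by fastforce
    then have "{v} \<subseteq> verts G" by simp
    then show ?thesis using proper[of v] le2 by blast
  next
    case False
    then have three: "3 \<le> card (verts G)" using two by simp
    show ?thesis
    proof (cases "parallel_free G (edges G) c")
      case True
      show ?thesis
      proof (rule ccontr)
        assume "\<not> ?thesis"
        then have no: "\<not> inj_on c (edge_cut G X)" if "X \<subseteq> verts G" "X \<noteq> {}" "X \<noteq> verts G" for X
          using that by blast
        have nr: "\<not> inj_on c (edge_star G (edges G) v)" if "v \<in> verts G" for v
          using no[of "{v}"] that proper[of v] by (simp add: cut_singleton[OF g])
        obtain h where "inj_on h (verts G)" "h ` verts G \<subseteq> c ` edges G"
          by (rule nonrainbow_stars_injection[OF fin(2) cl True nr])
        then have "card (verts G) \<le> card (c ` edges G)" using card_inj_on_le fin(2) by blast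
        then show False using lt by simp
      qed
    next
      case False
      then obtain e f where ef: "e \<in> edges G" "f \<in> edges G" "e \<noteq> f" "c e = c f"
        "ends G e = ends G f" "card (ends G e) = 2" by (auto simp: parallel_free_def)
      have cls: "{h\<in>edges G. c h = c e} = {e, f}"
        using card_seteq[of "{h\<in>edges G. c h = c e}" "{e, f}"] cl[OF ef(1)] fin ef by auto
      obtain u w where uw: "ends G e = {u, w}" "u \<noteq> w" using ef(6) by (auto simp: card_2_iff)
      have uwV: "u \<in> verts G" "w \<in> verts G" using uw g ef(1) by (auto simp: graph_def)
      \<comment> \<open>Merging the ends of a parallel class costs one vertex and one colour, so the
        strict inequality between the two counts survives.\<close>
      define \<phi> where "\<phi> = id(w := u)"
      define F where "F = {h\<in>edges G. c h \<noteq> c e}"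
      let ?Q = "quotient_graph G \<phi> F"
      have FE: "F \<subseteq> edges G" by (auto simp: F_def)
      have "\<phi> ` verts G = verts G - {w}" using uwV uw by (auto simp: \<phi>_def)
      then have cardV: "card (verts ?Q) = card (verts G) - 1" using uwV fin by simp
      have "c ` F = c ` edges G - {c e}" by (auto simp: F_def)
      then have cardc: "card (c ` edges ?Q) = card (c ` edges G) - 1" using ef(1) fin by simp
      have pos: "card (c ` edges G) > 0" using ef(1) fin by (auto simp: card_gt_0_iff)
      have cq: "edge_cut ?Q X = edge_cut G {v\<in>verts G. \<phi> v \<in> X}" for X
      proof (rule cut_quotient[OF g FE])
        fix h x y assume "h \<in> edges G - F" "x \<in> ends G h" "y \<in> ends G h"
        then have "h \<in> {e, f}" using cls by (auto simp: F_def)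
        then have "ends G h = {u, w}" using ef uw by auto
        then show "\<phi> x = \<phi> y" using \<open>x \<in> _\<close> \<open>y \<in> _\<close> by (auto simp: \<phi>_def)
      qed
      have "\<exists>X\<subseteq>verts ?Q. X \<noteq> {} \<and> X \<noteq> verts ?Q \<and> (card (edge_cut ?Q X) \<le> 2 \<or> inj_on c (edge_cut ?Q X))"
      proof (rule less.hyps)
        show "card (verts ?Q) < card (verts G)" using cardV three by linarith
        show "graph ?Q" by (rule graph_quotient[OF g FE])
        show "card (c ` edges ?Q) < card (verts ?Q)" using cardV cardc three lt pos by linarith
        show "2 \<le> card (verts ?Q)" using cardV three by linarith
        fix h assume "h \<in> edges ?Q"
        then have "{f\<in>edges ?Q. c f = c h} = {f\<in>edges G. c f = c h}" "h \<in> edges G"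
          by (auto simp: F_def)
        then show "card {f\<in>edges ?Q. c f = c h} \<le> 2" using cl by simp
      qed
      then obtain X where X: "X \<subseteq> \<phi> ` verts G" "X \<noteq> {}" "X \<noteq> \<phi> ` verts G"
        "card (edge_cut ?Q X) \<le> 2 \<or> inj_on c (edge_cut ?Q X)" unfolding quotient_simps by blast
      then have "{v\<in>verts G. \<phi> v \<in> X} \<noteq> {}" "{v\<in>verts G. \<phi> v \<in> X} \<noteq> verts G"
        by (simp_all only: quotient_preimage_trivial[OF X(1)] simp_thms)
      moreover have "{v\<in>verts G. \<phi> v \<in> X} \<subseteq> verts G" by blast
      ultimately show ?thesis using X(4) unfolding cq by blast
    qed
  qed
qed

text \<open>\<open>H\<close> stands for \<open>G3\<close>, or a contraction of it, and
  \<open>A\<close> for one side of the bond \<open>T\<close>. The last condition encodes that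
  \<open>G\<close> = \<open>H\<close> / \<open>T\<close> has no cut that is rainbow or has fewer
  than three edges. All conditions concern cuts and colour classes outside \<open>T\<close>, so they
  survive contracting a parallel class.\<close>

locale bond_split =
  fixes H :: "('v, 'e) mgraph" and T :: "'e set" and A :: "'v set" and c :: "'e \<Rightarrow> 'c" and n :: nat
  assumes graph_H: "graph H"
    and T_edges: "T \<subseteq> edges H" and card_T: "card T = 3"
    and card_verts: "card (verts H) = n + 3"
    and A_verts: "A \<subseteq> verts H" and cut_A: "edge_cut H A = T"
    and cut_within_T: "X \<subseteq> verts H \<Longrightarrow> edge_cut H X \<subseteq> T \<Longrightarrow> X \<in> {{}, verts H, A, verts H - A}"
    and card_colours: "card (c ` (edges H - T)) = n"
    and card_class: "e \<in> edges H - T \<Longrightarrow> card {f\<in>edges H - T. c f = c e} = 2"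
    and cut_avoiding_T: "X \<subseteq> verts H \<Longrightarrow> X \<noteq> {} \<Longrightarrow> X \<noteq> verts H \<Longrightarrow> edge_cut H X \<inter> T = {} \<Longrightarrow>
      3 \<le> card (edge_cut H X) \<and> \<not> inj_on c (edge_cut H X)"
begin

lemma finite_verts: "finite (verts H)" and finite_edges: "finite (edges H)"
  using graph_H by (auto simp: graph_def)

text \<open>Neither side of \<open>T\<close> is distinguished; a shape with a common end outside
  \<open>A\<close> is thereby reduced to one with a common end in \<open>A\<close>.\<close>

lemma swap_sides: "bond_split H T (verts H - A) c n"
proof -
  have "edge_cut H (verts H - A) = edge_cut H A"
    using graph_H by (fastforce simp: edge_cut_def graph_def)
  moreover have "verts H - (verts H - A) = A" using A_verts by auto
  moreover have "X \<in> {{}, verts H, verts H - A, A}" if "X \<subseteq> verts H" "edge_cut H X \<subseteq> T" for X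
    using cut_within_T[OF that] by blast
  ultimately show ?thesis
    using graph_H T_edges card_T card_verts card_colours card_class cut_avoiding_T cut_A
    by unfold_locales auto
qed

lemma T_ends:
  assumes "e \<in> T"
  obtains a b where "ends H e = {a, b}" "a \<in> A" "b \<in> verts H - A"
proof -
  obtain x y where xy: "ends H e = {x, y}" "x \<in> verts H" "y \<in> verts H"
    using graph_ends[OF graph_H] assms T_edges by blast
  moreover have "(x \<in> A) \<noteq> (y \<in> A)" using cut_iff[OF _ xy(1)] assms T_edges cut_A by blast
  ultimately show thesis using that[of x y] that[of y x] by (auto simp: insert_commute)
qed

text \<open>Without colours all edges lie in \<open>T\<close> and there are three vertices. Each
  single vertex would then be a full side of \<open>T\<close>, but there are only two sides.\<close>

lemma colours_pos: "0 < n"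
proof (rule ccontr)
  assume "\<not> 0 < n"
  then have "edges H - T = {}" using card_colours finite_edges by simp
  then have sub: "edge_cut H X \<subseteq> T" for X using cut_subset by fast
  have "(\<lambda>v. {v}) ` verts H \<subseteq> {A, verts H - A}"
  proof
    fix S assume "S \<in> (\<lambda>v. {v}) ` verts H"
    then obtain v where v: "S = {v}" "v \<in> verts H" by blast
    have "{v} \<noteq> verts H"
    proof
      assume "{v} = verts H"
      then have "card (verts H) = card {v}" by (rule arg_cong[OF sym])
      then show False using card_verts by simp
    qed
    then show "S \<in> {A, verts H - A}" using cut_within_T[OF _ sub, of S] v by auto
  qed
  then have "card (verts H) \<le> card {A, verts H - A}"
    using card_inj_on_le[of "\<lambda>v. {v}" "verts H" "{A, verts H - A}"] by simp
  also have "\<dots> \<le> 2" by (simp add: card_insert_if)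
  finally show False using card_verts by simp
qed

text \<open>
  If \<open>T\<close> contained a digon, contracting \<open>T\<close> would leave more vertices than colours.
\<close>

lemma not_parallel_in_T:
  assumes "e \<in> T" "f \<in> T" "e \<noteq> f"
  shows "ends H e \<noteq> ends H f"
proof
  assume par: "ends H e = ends H f"
  obtain h where T: "T = {e, f, h}"
  proof -
    have "card (T - {e, f}) = 1" using assms card_T by (simp add: card_Diff_subset)
    then obtain h where "T - {e, f} = {h}" by (auto simp: card_1_singleton_iff)
    then show thesis using assms that[of h] by blast
  qed
  obtain a b where ab: "ends H e = {a, b}" "a \<in> A" "b \<in> verts H - A" using T_ends[OF assms(1)] by metis
  obtain a' b' where ab': "ends H h = {a', b'}" "a' \<in> A" "b' \<in> verts H - A"
    using T_ends[of h] T by blast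
  \<comment> \<open>If \<open>b = b'\<close>, the edges of \<open>T\<close> are connected and all
    their ends must go to \<open>a\<close>; merging \<open>b'\<close> into \<open>a'\<close> as well
    would override the image of \<open>b\<close>. Otherwise each outer end goes to its partner in
    \<open>A\<close>.\<close>
  define \<phi> where "\<phi> = (if b = b' then id(b := a, a' := a) else id(b := a, b' := a'))"
  let ?Q = "quotient_graph H \<phi> (edges H - T)"
  have const: "\<phi> x = \<phi> y" if "k \<in> edges H - (edges H - T)" "x \<in> ends H k" "y \<in> ends H k" for k x y
  proof -
    have "k \<in> {e, f, h}" using that(1) T by blast
    then have "ends H k = {a, b} \<or> ends H k = {a', b'}" using ab(1) ab'(1) par by auto
    moreover have "\<phi> a = \<phi> b" "\<phi> a' = \<phi> b'" using ab ab' by (auto simp: \<phi>_def)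
    ultimately show ?thesis using that(2,3) by (elim disjE) auto
  qed
  \<comment> \<open>The vertices that may be moved: at most two, so at least n + 3 - 2 = n + 1
    remain as images.\<close>
  define D where "D = (if b = b' then {b, a'} else {b, b'})"
  have "card D \<le> 2" by (auto simp: D_def card_insert_if)
  then have "n + 1 \<le> card (verts H - D)"
    using diff_card_le_card_Diff[of D "verts H"] card_verts by (auto simp: D_def)
  also have "\<dots> \<le> card (\<phi> ` verts H)"
  proof (rule card_mono)
    have "v \<in> \<phi> ` verts H" if "v \<in> verts H - D" for v
    proof -
      have "\<phi> v = v" using that by (auto simp: \<phi>_def D_def split: if_splits)
      then show ?thesis using that by (metis DiffD1 imageI)
    qed
    then show "verts H - D \<subseteq> \<phi> ` verts H" by blast
  qed (simp add: finite_verts)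
  finally have card: "n + 1 \<le> card (verts ?Q)" by simp
  \<comment> \<open>There are n colours and at least n + 1 vertices, so some cut of the contraction
    is small or rainbow. It avoids \<open>T\<close>, which contradicts
    \<open>cut_avoiding_T\<close>.\<close>
  have "\<exists>X\<subseteq>verts ?Q. X \<noteq> {} \<and> X \<noteq> verts ?Q \<and> (card (edge_cut ?Q X) \<le> 2 \<or> inj_on c (edge_cut ?Q X))"
  proof (rule exists_small_or_rainbow_cut)
    show "graph ?Q" by (rule graph_quotient[OF graph_H]) auto
    show "card {f \<in> edges ?Q. c f = c e} \<le> 2" if "e \<in> edges ?Q" for e using card_class that by simp
  qed (use card card_colours colours_pos in auto)
  then obtain X where X: "X \<subseteq> \<phi> ` verts H" "X \<noteq> {}" "X \<noteq> \<phi> ` verts H"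
    "card (edge_cut ?Q X) \<le> 2 \<or> inj_on c (edge_cut ?Q X)" unfolding quotient_simps by blast
  define Y where "Y = {v\<in>verts H. \<phi> v \<in> X}"
  have Y: "Y \<subseteq> verts H" "Y \<noteq> {}" "Y \<noteq> verts H"
    unfolding Y_def using X(2,3) by (auto simp only: quotient_preimage_trivial[OF X(1)])
  have cutY: "edge_cut ?Q X = edge_cut H Y"
    unfolding Y_def by (rule cut_quotient[OF graph_H _ const]) auto
  have "edge_cut H Y \<inter> T = {}" using cut_subset[of ?Q X] unfolding cutY by auto
  then have "3 \<le> card (edge_cut H Y)" "\<not> inj_on c (edge_cut H Y)" using cut_avoiding_T[OF Y] by simp_all
  then show False using X(4) unfolding cutY by simp
qed

end

section \<open>Counting in the absence of parallel colour classes\<close>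

text \<open>States the goal without extending the colouring: one edge of the freshly coloured
  \<open>T\<close> does not spoil a rainbow set, two would.\<close>

definition disjoint_rainbow_cuts :: "('v, 'e) mgraph \<Rightarrow> 'e set \<Rightarrow> ('e \<Rightarrow> 'c) \<Rightarrow> nat \<Rightarrow> bool" where
  "disjoint_rainbow_cuts H T c n \<longleftrightarrow> (\<exists>X Y e f. X \<subseteq> verts H \<and> Y \<subseteq> verts H \<and> e \<noteq> f \<and>
     edge_cut H X \<inter> T = {e} \<and> edge_cut H Y \<inter> T = {f} \<and> edge_cut H X \<inter> edge_cut H Y = {} \<and>
     inj_on c (edge_cut H X - T) \<and> inj_on c (edge_cut H Y - T) \<and>
     card (edge_cut H X) + card (edge_cut H Y) \<le> n + 3)"

locale reduced_bond_split = bond_split +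
  assumes parallel_free: "parallel_free H (edges H - T) c"
begin

definition st :: "'a \<Rightarrow> 'b set" where
  "st v = edge_star H (edges H - T) v"

text \<open>Integer-valued, so that the degree inequalities can be handled by linear arithmetic
  without truncated subtraction.\<close>

definition d :: "'a \<Rightarrow> int" where
  "d v = int (card (st v))"

definition N :: "'a set" where
  "N = {v\<in>verts H. inj_on c (st v)}"

definition VT :: "'a set" where
  "VT = \<Union> (ends H ` T)"

text \<open>The \<open>T\<close>-edge \<open>e\<close> below is determined by \<open>x\<close> unless \<open>x\<close> meets all of \<open>T\<close> or none of it.\<close>

definition completes :: "'a \<Rightarrow> 'b \<Rightarrow> bool" where
  "completes x e \<longleftrightarrow> e \<in> T \<and> (\<exists>X\<subseteq>verts H. edge_cut H X = insert e (st x))"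

lemma swap: "reduced_bond_split H T (verts H - A) c n"
  using swap_sides parallel_free
  by (simp add: reduced_bond_split_def reduced_bond_split_axioms_def)

lemma st_subset: "st v \<subseteq> edges H - T"
  by (auto simp: st_def edge_star_def)

lemma finite_st: "finite (st v)"
  using st_subset finite_edges finite_subset finite_Diff by metis

lemma N_verts: "v \<in> N \<Longrightarrow> v \<in> verts H" and inj_on_st: "v \<in> N \<Longrightarrow> inj_on c (st v)"
  by (auto simp: N_def)

lemma finite_N: "finite N"
  using finite_verts by (simp add: N_def)

lemma card_st_le:
  assumes "v \<in> N"
  shows "card (st v) \<le> n"
proof -
  have "card (c ` st v) \<le> card (c ` (edges H - T))"
    using st_subset finite_edges by (intro card_mono) auto
  then show ?thesis using card_image[OF inj_on_st[OF assms]] card_colours by simp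
qed

lemma card_T_ends: "e \<in> T \<Longrightarrow> card (ends H e) = 2"
  by (erule T_ends) (auto simp: card_insert_if)

lemma cut_vertex: "edge_cut H {v} = st v \<union> {e\<in>T. v \<in> ends H e}"
  using T_edges card_T_ends by (auto simp: cut_singleton[OF graph_H] edge_star_def st_def)

lemma edge_side:
  assumes "e \<in> edges H - T"
  shows "ends H e \<subseteq> A \<or> ends H e \<subseteq> verts H - A"
proof -
  have e: "e \<in> edges H" "e \<notin> edge_cut H A" using assms cut_A by auto
  obtain x y where xy: "ends H e = {x, y}" "x \<in> verts H" "y \<in> verts H"
    by (rule graph_ends[OF graph_H e(1)])
  then show ?thesis using cut_iff[OF e(1) xy(1)] e(2) by auto
qed

lemma st_end: "e \<in> st v \<Longrightarrow> v \<in> ends H e"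
  by (simp add: st_def edge_star_def)

lemma st_ends: "e \<in> st v \<Longrightarrow> e \<in> st w \<Longrightarrow> v \<noteq> w \<Longrightarrow> ends H e = {v, w}"
  by (simp add: st_def edge_star_def card_2_superset_eq)

lemma st_disjoint_sides:
  assumes "x \<in> A" "y \<notin> A"
  shows "st x \<inter> st y = {}"
proof -
  have False if "e \<in> st x" "e \<in> st y" for e
  proof -
    have "e \<in> edges H - T" using st_subset that by blast
    then show False using edge_side[of e] st_end[OF that(1)] st_end[OF that(2)] assms by blast
  qed
  then show ?thesis by blast
qed

lemma completes_single:
  assumes "x \<in> verts H" "e \<in> T" "{f\<in>T. x \<in> ends H f} = {e}"
  shows "completes x e"
  using assms cut_vertex[of x] by (auto simp: completes_def intro!: exI[of _ "{x}"])

text \<open>Adding the cut \<open>T\<close> modulo 2 to the cut around \<open>x\<close> trades the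
  two edges of \<open>T\<close> at \<open>x\<close> for the third one.\<close>

lemma completes_double:
  assumes "x \<in> verts H" "e \<in> T" "{f\<in>T. x \<in> ends H f} = T - {e}"
  shows "completes x e"
proof -
  let ?X = "({x} - A) \<union> (A - {x})"
  have "f \<in> edge_cut H ?X \<longleftrightarrow> f \<in> insert e (st x)" for f
  proof (cases "f \<in> edges H")
    case True
    have "f \<in> edge_cut H ?X \<longleftrightarrow> (f \<in> st x \<union> (T - {e})) \<noteq> (f \<in> T)"
      using cut_symdiff_iff[OF graph_H True, of "{x}" A] cut_vertex[of x] assms(3) cut_A by simp
    then show ?thesis using assms(2) st_subset[of x] by blast
  next
    case False
    then have "f \<notin> edge_cut H ?X" "f \<notin> st x" "f \<noteq> e"
      using cut_subset[of H ?X] st_subset[of x] assms(2) T_edges by auto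
    then show ?thesis by simp
  qed
  moreover have "?X \<subseteq> verts H" using A_verts assms(1) by auto
  ultimately show ?thesis using assms(2) unfolding completes_def by (intro conjI exI[of _ ?X] set_eqI)
qed

text \<open>Each cut is a star plus one edge of \<open>T\<close>, hence the total n + 1 + 2.\<close>

lemma combine:
  assumes "x \<in> N" "y \<in> N" "completes x e" "completes y f" "e \<noteq> f" "st x \<inter> st y = {}"
    and "card (st x) + card (st y) \<le> n + 1"
  shows "disjoint_rainbow_cuts H T c n"
proof -
  obtain X Y where X: "X \<subseteq> verts H" "edge_cut H X = insert e (st x)"
    and Y: "Y \<subseteq> verts H" "edge_cut H Y = insert f (st y)" and ef: "e \<in> T" "f \<in> T"
    using assms(3,4) by (auto simp: completes_def)
  have sub: "st x \<inter> T = {}" "st y \<inter> T = {}" using st_subset by blast+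
  then have nin: "e \<notin> st x" "f \<notin> st y" "e \<notin> st y" "f \<notin> st x" using ef by blast+
  have "edge_cut H X \<inter> T = {e}" "edge_cut H Y \<inter> T = {f}" using X Y ef sub by auto
  moreover have "edge_cut H X - T = st x" "edge_cut H Y - T = st y" using X Y ef sub by auto
  moreover have "edge_cut H X \<inter> edge_cut H Y = {}" using X(2) Y(2) nin assms(5,6) by auto
  moreover have "card (edge_cut H X) + card (edge_cut H Y) \<le> n + 3"
    using X(2) Y(2) nin assms(7) finite_st by simp
  ultimately show ?thesis
    unfolding disjoint_rainbow_cuts_def using X(1) Y(1) assms(1,2,5) inj_on_st
    by (intro exI[of _ X] exI[of _ Y] exI[of _ e] exI[of _ f]) simp
qed

text \<open>The contrapositive form used for the shapes: if the desired cuts are missing, degree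
  sums are large. On opposite sides the stars are disjoint automatically.\<close>

lemma combine_sides:
  assumes "x \<in> N" "y \<in> N" "completes x e" "completes y f" "e \<noteq> f" "x \<in> A" "y \<notin> A"
    and "\<not> disjoint_rainbow_cuts H T c n"
  shows "int n + 2 \<le> d x + d y"
  using combine[OF assms(1-5) st_disjoint_sides[OF assms(6,7)]] assms(8) unfolding d_def by linarith

lemma proper_vertex: "{v} \<noteq> verts H"
proof
  assume "{v} = verts H"
  then have "card (verts H) = card {v}" by (rule arg_cong[OF sym])
  then show False using card_verts by simp
qed

lemma cut_vertex_outside:
  assumes "v \<in> verts H" "v \<notin> VT"
  shows "3 \<le> card (st v)" "\<not> inj_on c (st v)"
proof -
  have "{e\<in>T. v \<in> ends H e} = {}" using assms(2) by (auto simp: VT_def)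
  then have eq: "edge_cut H {v} = st v" by (simp only: cut_vertex Un_empty_right)
  then have "edge_cut H {v} \<inter> T = {}" using st_subset by blast
  then have "3 \<le> card (edge_cut H {v}) \<and> \<not> inj_on c (edge_cut H {v})"
    using cut_avoiding_T[of "{v}"] assms(1) proper_vertex by simp
  then show "3 \<le> card (st v)" "\<not> inj_on c (st v)" unfolding eq by simp_all
qed

lemma N_VT: "N \<subseteq> VT"
  using cut_vertex_outside(2) by (auto simp: N_def)

lemma finite_VT: "finite VT" and VT_verts: "VT \<subseteq> verts H"
proof -
  show "VT \<subseteq> verts H" using T_edges graph_H by (auto simp: VT_def graph_def)
  then show "finite VT" using finite_verts finite_subset by blast
qed

lemma card_st_centre:
  assumes "v \<in> verts H - N"
  shows "2 \<le> card (st v)"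
proof -
  obtain e f where "e \<in> st v" "f \<in> st v" "e \<noteq> f" using assms by (auto simp: N_def inj_on_def)
  then show ?thesis using card_mono[OF finite_st[of v], of "{e, f}"] by simp
qed

text \<open>If \<open>v\<close> has no coloured non-loop edge, its cut lies within \<open>T\<close>,
  so \<open>v\<close> alone is a side of the bond.\<close>

lemma card_st_pos:
  assumes "v \<in> verts H" "{v} \<noteq> A" "{v} \<noteq> verts H - A"
  shows "1 \<le> d v"
proof (rule ccontr)
  assume "\<not> 1 \<le> d v"
  then have "card (st v) = 0" by (simp add: d_def)
  then have "st v = {}" using finite_st[of v] by simp
  then have "edge_cut H {v} \<subseteq> T" using cut_vertex[of v] by auto
  then show False using cut_within_T[of "{v}"] assms proper_vertex[of v] by auto
qed

text \<open>
  Hence an edge joining two vertices of \<open>N\<close>, or a colour on both sides of the cut \<open>T\<close>, has its colour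
  in \<open>Bad\<close>.
\<close>

lemma card_noncentres:
  obtains Bad where "card Bad + 3 = card N" "finite Bad"
    "\<forall>e\<in>edges H - T. c e \<notin> Bad \<longrightarrow> (\<exists>v\<in>verts H - N. {f\<in>edges H - T. c f = c e} \<subseteq> st v)"
proof -
  have fin: "finite (edges H - T)" using finite_edges by simp
  have cl: "card {f\<in>edges H - T. c f = c e} \<le> 2" if "e \<in> edges H - T" for e
    using card_class[OF that] by simp
  have nr: "\<not> inj_on c (edge_star H (edges H - T) v)" if "v \<in> verts H - N" for v
    using that by (auto simp: N_def st_def)
  obtain g where g: "inj_on g (verts H - N)" "g ` (verts H - N) \<subseteq> c ` (edges H - T)"
    "\<forall>v\<in>verts H - N. {f\<in>edges H - T. c f = g v} \<subseteq> edge_star H (edges H - T) v"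
    by (rule nonrainbow_stars_injection[OF fin cl parallel_free nr])
  \<comment> \<open>The colours missed by the injection. Their number is n - (n + 3 - |N|) = |N| -
    3.\<close>
  define Bad where "Bad = c ` (edges H - T) - g ` (verts H - N)"
  have "card Bad = n - card (verts H - N)"
    unfolding Bad_def using card_Diff_subset[OF _ g(2)] finite_verts card_image[OF g(1)] card_colours by simp
  moreover have "card (verts H - N) \<le> n"
    using card_inj_on_le[OF g(1,2)] fin card_colours by simp
  moreover have "card (verts H - N) = card (verts H) - card N"
    using finite_N N_verts by (intro card_Diff_subset) auto
  moreover have "card N \<le> card (verts H)" using finite_verts N_verts by (intro card_mono) auto
  ultimately have "card Bad + 3 = card N" using card_verts by linarith
  moreover have "finite Bad" using fin by (simp add: Bad_def)
  moreover have "\<exists>v\<in>verts H - N. {f\<in>edges H - T. c f = c e} \<subseteq> st v"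
    if eB: "e \<in> edges H - T" "c e \<notin> Bad" for e
  proof -
    obtain v where v: "v \<in> verts H - N" "c e = g v" using eB by (auto simp: Bad_def)
    show ?thesis using bspec[OF g(3) v(1)] v unfolding st_def by auto
  qed
  then have "\<forall>e\<in>edges H - T. c e \<notin> Bad \<longrightarrow> (\<exists>v\<in>verts H - N. {f\<in>edges H - T. c f = c e} \<subseteq> st v)"
    by (intro ballI impI)
  ultimately show thesis by (rule that)
qed

lemma card_N_ge: "3 \<le> int (card N)"
  by (rule card_noncentres) linarith

section \<open>Degree counting outside \<open>T\<close>\<close>

lemma card_coloured: "card (edges H - T) = 2 * n"
proof -
  have "card (edges H - T) = (\<Sum>k\<in>c ` (edges H - T). card {e\<in>edges H - T. c e = k})"
    using sum.image_gen[of "edges H - T" "\<lambda>_. 1::nat" c] finite_edges by simp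
  also have "\<dots> = (\<Sum>k\<in>c ` (edges H - T). 2)"
    by (rule sum.cong[OF refl]) (use card_class in auto)
  finally show ?thesis using card_colours by simp
qed

text \<open>Handshake count over 2n coloured edges; it is only an inequality because loops lie in no
  star.\<close>

lemma sum_card_st: "(\<Sum>v\<in>verts H. card (st v)) \<le> 4 * n"
proof -
  let ?E = "edges H - T"
  have fin: "finite ?E" using finite_edges by simp
  have "(\<Sum>v\<in>verts H. card (st v)) = (\<Sum>v\<in>verts H. \<Sum>e\<in>?E. of_bool (e \<in> st v))"
  proof (rule sum.cong[OF refl])
    fix v
    have "?E \<inter> {e. e \<in> st v} = st v" using st_subset by blast
    then show "card (st v) = (\<Sum>e\<in>?E. of_bool (e \<in> st v))" using fin by (simp add: sum_of_bool_eq)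
  qed
  also have "\<dots> = (\<Sum>e\<in>?E. \<Sum>v\<in>verts H. of_bool (e \<in> st v))" by (rule sum.swap)
  also have "\<dots> \<le> (\<Sum>e\<in>?E. 2)"
  proof (rule sum_mono)
    fix e assume "e \<in> ?E"
    have "(\<Sum>v\<in>verts H. of_bool (e \<in> st v)) = card (verts H \<inter> {v. e \<in> st v})"
      using finite_verts by (simp add: sum_of_bool_eq)
    also have "\<dots> \<le> card (ends H e)"
    proof (rule card_mono)
      show "finite (ends H e)"
        using \<open>e \<in> ?E\<close> graph_H finite_verts by (auto simp: graph_def intro: finite_subset)
      show "verts H \<inter> {v. e \<in> st v} \<subseteq> ends H e" using st_end by blast
    qed
    also have "\<dots> \<le> 2" using \<open>e \<in> ?E\<close> graph_H by (auto simp: graph_def)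
    finally show "(\<Sum>v\<in>verts H. of_bool (e \<in> st v)) \<le> (2::nat)" .
  qed
  also have "\<dots> = 4 * n" using card_coloured by simp
  finally show ?thesis .
qed

text \<open>Outside \<open>N\<close> a vertex has degree at least 3, or at least 2 if it lies in
  \<open>VT\<close>. Subtracting 3(n + 3 - |N|) - (|VT| - |N|) from 4n leaves n + 2|N| + |VT| -
  9.\<close>

lemma sum_card_st_N: "(\<Sum>v\<in>N. card (st v)) + 9 \<le> n + 2 * card N + card VT"
proof -
  let ?Z = "verts H - N"
  have sub: "N \<subseteq> verts H" using N_verts by blast
  have cZ: "card ?Z + card N = n + 3"
    using card_Diff_subset[OF finite_N sub] card_mono[OF finite_verts sub] card_verts by simp
  have cVZ: "card (VT - N) + card N = card VT"
    using card_Diff_subset[OF finite_N N_VT] card_mono[OF finite_VT N_VT] by simp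
  have "3 * card ?Z = (\<Sum>v\<in>?Z. 3)" by simp
  also have "\<dots> \<le> (\<Sum>v\<in>?Z. card (st v) + of_bool (v \<in> VT))"
  proof (rule sum_mono)
    fix v assume "v \<in> ?Z"
    then show "3 \<le> card (st v) + of_bool (v \<in> VT)"
      using card_st_centre[of v] cut_vertex_outside(1)[of v] by (cases "v \<in> VT") auto
  qed
  also have "\<dots> = (\<Sum>v\<in>?Z. card (st v)) + card (?Z \<inter> VT)"
    using finite_verts by (simp add: sum.distrib sum_of_bool_eq)
  also have "?Z \<inter> VT = VT - N" using VT_verts by blast
  finally have "3 * card ?Z \<le> (\<Sum>v\<in>?Z. card (st v)) + card (VT - N)" .
  moreover have "(\<Sum>v\<in>verts H. card (st v)) = (\<Sum>v\<in>?Z. card (st v)) + (\<Sum>v\<in>N. card (st v))"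
    by (rule sum.subset_diff[OF sub finite_verts])
  ultimately show ?thesis using sum_card_st cZ cVZ by linarith
qed

text \<open>Supplies the lower bounds on n for the shapes with five or six ends.\<close>

lemma card_VT_le: "card VT \<le> n + 3"
  using card_mono[OF finite_verts VT_verts] card_verts by simp

text \<open>No colour is left over. The class of an edge between \<open>x\<close> and
  \<open>y\<close> would lie in the star of a vertex outside \<open>N\<close>, but the ends of that
  edge are \<open>x\<close> and \<open>y\<close>.\<close>

lemma N_stable:
  assumes "int (card N) = 3" "x \<in> N" "y \<in> N" "x \<noteq> y"
  shows "st x \<inter> st y = {}"
proof -
  obtain Bad where Bad: "card Bad + 3 = card N" "finite Bad"
    "\<forall>e\<in>edges H - T. c e \<notin> Bad \<longrightarrow> (\<exists>v\<in>verts H - N. {f\<in>edges H - T. c f = c e} \<subseteq> st v)"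
    by (rule card_noncentres)
  have "Bad = {}" using Bad(1,2) assms(1) by simp
  have False if e: "e \<in> st x" "e \<in> st y" for e
  proof -
    have eE: "e \<in> edges H - T" using e st_subset by blast
    then obtain v where v: "v \<in> verts H - N" "{f\<in>edges H - T. c f = c e} \<subseteq> st v"
      using bspec[OF Bad(3) eE] \<open>Bad = {}\<close> by blast
    then have "e \<in> st v" using eE by blast
    then have "v \<in> ends H e" by (rule st_end)
    moreover have "ends H e = {x, y}" using st_ends e assms(4) by blast
    ultimately show False using v(1) assms(2,3) by auto
  qed
  then show ?thesis by blast
qed

text \<open>Adding the two cuts cancels \<open>e\<close> and leaves \<open>st x\<close> together
  with \<open>st y\<close>, a cut avoiding \<open>T\<close>; positive degree makes its side proper.
  It must repeat a colour, necessarily on opposite sides of \<open>T\<close>. With no colour left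
  over, that class lies in a single star, hence on one side.\<close>

lemma completes_common:
  assumes "int (card N) = 3" "x \<in> N" "y \<in> N" "x \<in> A" "y \<notin> A" "completes x e" "completes y e" "1 \<le> d x"
  shows False
proof -
  obtain Bad where Bad: "card Bad + 3 = card N" "finite Bad"
    "\<forall>e\<in>edges H - T. c e \<notin> Bad \<longrightarrow> (\<exists>v\<in>verts H - N. {f\<in>edges H - T. c f = c e} \<subseteq> st v)"
    by (rule card_noncentres)
  have "Bad = {}" using Bad(1,2) assms(1) by simp
  obtain X Y where X: "X \<subseteq> verts H" "edge_cut H X = insert e (st x)"
    and Y: "Y \<subseteq> verts H" "edge_cut H Y = insert e (st y)" and eT: "e \<in> T"
    using assms(6,7) by (auto simp: completes_def)
  let ?W = "(X - Y) \<union> (Y - X)"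
  have disj: "st x \<inter> st y = {}" by (rule st_disjoint_sides[OF assms(4,5)])
  have nin: "e \<notin> st x" "e \<notin> st y" using st_subset eT by blast+
  have W: "edge_cut H ?W = st x \<union> st y"
  proof (rule set_eqI)
    fix f
    show "f \<in> edge_cut H ?W \<longleftrightarrow> f \<in> st x \<union> st y"
    proof (cases "f \<in> edges H")
      case True
      then show ?thesis using cut_symdiff_iff[OF graph_H True, of X Y] X(2) Y(2) disj nin by auto
    next
      case False
      then show ?thesis using cut_subset[of H ?W] st_subset[of x] st_subset[of y] by blast
    qed
  qed
  obtain k where k: "k \<in> st x" using assms(8) unfolding d_def by fastforce
  have ne: "?W \<noteq> {}" "?W \<noteq> verts H"
  proof -
    have "k \<in> edge_cut H ?W" using W k by simp
    moreover have "k \<in> edges H" using k st_subset by blast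
    then have "ends H k \<subseteq> verts H" using graph_H by (simp add: graph_def)
    ultimately show "?W \<noteq> {}" "?W \<noteq> verts H" unfolding edge_cut_def by auto
  qed
  have "edge_cut H ?W \<inter> T = {}" unfolding W using st_subset by blast
  moreover have "?W \<subseteq> verts H" using X(1) Y(1) by blast
  ultimately have "\<not> inj_on c (st x \<union> st y)" using cut_avoiding_T[of ?W] ne unfolding W by simp
  then obtain f h where fh: "f \<in> st x" "h \<in> st y" "c f = c h"
    using inj_on_st[OF assms(2)] inj_on_st[OF assms(3)] unfolding inj_on_def by (metis Un_iff)
  have E: "f \<in> edges H - T" "h \<in> edges H - T" using fh st_subset by blast+
  obtain v where v: "v \<in> verts H - N" "{h\<in>edges H - T. c h = c f} \<subseteq> st v"
    using bspec[OF Bad(3) E(1)] \<open>Bad = {}\<close> by blast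
  then have "f \<in> st v" "h \<in> st v" using E fh(3) by auto
  then have "v \<in> ends H f" "v \<in> ends H h" by (simp_all add: st_end)
  then show False
    using edge_side[OF E(1)] edge_side[OF E(2)] st_end[OF fh(1)] st_end[OF fh(2)] assms(4,5) by blast
qed

text \<open>If the star of \<open>u\<close> used all n colours, every edge at the \<open>x\<close>'s
  would share its colour with an edge on the other side, so it would have the single left-over
  colour. Two such edges and one at \<open>u\<close> exceed the class size 2.\<close>

lemma card_st_less:
  assumes "int (card N) = 4" "u \<in> N" and x: "x1 \<noteq> x2" "x1 \<noteq> x3" "x2 \<noteq> x3"
    and side: "\<And>x. x \<in> {x1, x2, x3} \<Longrightarrow> (x \<in> A) \<noteq> (u \<in> A)"
    and pos: "\<And>x. x \<in> {x1, x2, x3} \<Longrightarrow> 1 \<le> d x"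
  shows "d u + 1 \<le> int n"
proof (rule ccontr)
  assume "\<not> ?thesis"
  then have "card (st u) = n" using card_st_le[OF assms(2)] by (simp add: d_def)
  then have "card (c ` st u) = n" using card_image[OF inj_on_st[OF assms(2)]] by simp
  then have all: "c ` st u = c ` (edges H - T)"
    using st_subset finite_edges card_colours by (intro card_seteq) auto
  obtain Bad where Bad: "card Bad + 3 = card N" "finite Bad"
    "\<forall>e\<in>edges H - T. c e \<notin> Bad \<longrightarrow> (\<exists>v\<in>verts H - N. {f\<in>edges H - T. c f = c e} \<subseteq> st v)"
    by (rule card_noncentres)
  have bad: "c f \<in> Bad \<and> (\<exists>f'\<in>st u. c f' = c f \<and> f' \<noteq> f)" if f: "f \<in> st x" "x \<in> {x1, x2, x3}" for f x
  proof -
    have fE: "f \<in> edges H - T" using f st_subset by blast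
    then obtain f' where f': "f' \<in> st u" "c f' = c f" using all by (metis imageE imageI)
    have f'E: "f' \<in> edges H - T" using f' st_subset by blast
    have no: "\<not> (v \<in> ends H f \<and> v \<in> ends H f')" for v
      using edge_side[OF fE] edge_side[OF f'E] st_end[OF f(1)] st_end[OF f'(1)] side[OF f(2)] by blast
    have "c f \<in> Bad"
    proof (rule ccontr)
      assume "c f \<notin> Bad"
      then obtain v where "{h\<in>edges H - T. c h = c f} \<subseteq> st v" using bspec[OF Bad(3) fE] by blast
      then have "f \<in> st v" "f' \<in> st v" using fE f'E f'(2) by auto
      then show False using no st_end by blast
    qed
    moreover have "f' \<noteq> f" using no st_end[OF f(1)] by blast
    ultimately show ?thesis using f' by blast
  qed
  obtain f1 f2 f3 where f: "f1 \<in> st x1" "f2 \<in> st x2" "f3 \<in> st x3"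
    using pos[of x1] pos[of x2] pos[of x3] unfolding d_def by fastforce
  \<comment> \<open>One edge has only two ends and cannot serve three vertices.\<close>
  have "\<not> (f1 = f2 \<and> f2 = f3)" using st_ends[of f1 x1 x2] st_end[of f1 x3] f x by auto
  then obtain f h x y where fh: "f \<in> st x" "h \<in> st y" "f \<noteq> h" "x \<in> {x1, x2, x3}" "y \<in> {x1, x2, x3}"
    using f by blast
  have "card Bad = 1" using Bad(1) assms(1) by simp
  then have eq: "c f = c h" using bad[OF fh(1,4)] bad[OF fh(2,5)] by (auto simp: card_1_singleton_iff)
  obtain f' where f': "f' \<in> st u" "c f' = c f" "f' \<noteq> f" using bad[OF fh(1,4)] by blast
  obtain h' where h': "h' \<in> st u" "c h' = c h" "h' \<noteq> h" using bad[OF fh(2,5)] by blast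
  have "f' = h'" using inj_on_st[OF assms(2)] f' h' eq by (auto simp: inj_on_def)
  then have "{f, h, f'} \<subseteq> {k\<in>edges H - T. c k = c f}" "card {f, h, f'} = 3"
    using fh f' h' eq st_subset[of x] st_subset[of y] st_subset[of u] by auto
  then have "3 \<le> card {k\<in>edges H - T. c k = c f}"
    using card_mono[of "{k\<in>edges H - T. c k = c f}" "{f, h, f'}"] finite_edges by simp
  then show False using card_class[of f] fh(1) st_subset by fastforce
qed

text \<open>In each shape \<open>VT\<close> is an explicit finite set while \<open>N\<close> is
  unknown; sums over \<open>N\<close> then unfold into conditional terms.\<close>

lemma sum_N_over_VT: "(\<Sum>v\<in>N. g v) = (\<Sum>v\<in>VT. if v \<in> N then g v else 0)"
  for g :: "'a \<Rightarrow> int"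
proof -
  have "VT \<inter> N = N" using N_VT by blast
  then show ?thesis using sum.inter_restrict[OF finite_VT, of g N] by simp
qed

lemma card_N_over_VT: "int (card N) = (\<Sum>v\<in>VT. if v \<in> N then 1 else 0)"
  using sum_N_over_VT[of "\<lambda>_. 1"] by simp

lemma sum_d_over_VT: "(\<Sum>v\<in>VT. if v \<in> N then d v else 0) + 9 \<le> int n + 2 * int (card N) + int (card VT)"
proof -
  have "int ((\<Sum>v\<in>N. card (st v)) + 9) \<le> int (n + 2 * card N + card VT)"
    using sum_card_st_N by (simp only: of_nat_le_iff)
  then show ?thesis by (simp add: d_def sum_N_over_VT[symmetric])
qed

lemma d_le: "v \<in> N \<Longrightarrow> d v \<le> int n"
  using card_st_le by (simp add: d_def)

end

section \<open>The shapes of the forest\<close>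

context reduced_bond_split
begin

lemma d_nonneg: "0 \<le> d v"
  by (simp add: d_def)

lemma colours_pos': "0 < int n"
  using colours_pos by simp

text \<open>Vertices may coincide; the pattern of equalities among the \<open>a\<close>'s and among
  the \<open>b\<close>'s is the shape of \<open>T\<close>.\<close>

definition labelled :: "'b \<Rightarrow> 'a \<Rightarrow> 'a \<Rightarrow> 'b \<Rightarrow> 'a \<Rightarrow> 'a \<Rightarrow> 'b \<Rightarrow> 'a \<Rightarrow> 'a \<Rightarrow> bool" where
  "labelled e1 a1 b1 e2 a2 b2 e3 a3 b3 \<longleftrightarrow> T = {e1, e2, e3} \<and> e1 \<noteq> e2 \<and> e1 \<noteq> e3 \<and> e2 \<noteq> e3 \<and>
     ends H e1 = {a1, b1} \<and> ends H e2 = {a2, b2} \<and> ends H e3 = {a3, b3} \<and>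
     a1 \<in> A \<and> a2 \<in> A \<and> a3 \<in> A \<and> b1 \<in> verts H - A \<and> b2 \<in> verts H - A \<and> b3 \<in> verts H - A"

lemma labelled_swap12:
  "labelled e1 a1 b1 e2 a2 b2 e3 a3 b3 \<Longrightarrow> labelled e2 a2 b2 e1 a1 b1 e3 a3 b3"
  unfolding labelled_def by (elim conjE, intro conjI) (simp_all add: insert_commute)

lemma labelled_swap23:
  "labelled e1 a1 b1 e2 a2 b2 e3 a3 b3 \<Longrightarrow> labelled e1 a1 b1 e3 a3 b3 e2 a2 b2"
  unfolding labelled_def by (elim conjE, intro conjI) (simp_all add: insert_commute)

lemma labelled_sides: "labelled e1 a1 b1 e2 a2 b2 e3 a3 b3 \<Longrightarrow>
  reduced_bond_split.labelled H T (verts H - A) e1 b1 a1 e2 b2 a2 e3 b3 a3"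
  unfolding reduced_bond_split.labelled_def[OF swap] labelled_def
  using A_verts by (auto simp: insert_commute)

lemma obtain_labelled:
  obtains e1 a1 b1 e2 a2 b2 e3 a3 b3 where "labelled e1 a1 b1 e2 a2 b2 e3 a3 b3"
proof -
  obtain e1 e2 e3 where T: "T = {e1, e2, e3}" "e1 \<noteq> e2" "e1 \<noteq> e3" "e2 \<noteq> e3"
    using card_T by (auto simp: card_3_iff)
  obtain a1 b1 where 1: "ends H e1 = {a1, b1}" "a1 \<in> A" "b1 \<in> verts H - A"
    by (rule T_ends[of e1]) (use T in auto)
  obtain a2 b2 where 2: "ends H e2 = {a2, b2}" "a2 \<in> A" "b2 \<in> verts H - A"
    by (rule T_ends[of e2]) (use T in auto)
  obtain a3 b3 where 3: "ends H e3 = {a3, b3}" "a3 \<in> A" "b3 \<in> verts H - A"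
    by (rule T_ends[of e3]) (use T in auto)
  have "labelled e1 a1 b1 e2 a2 b2 e3 a3 b3" unfolding labelled_def using T 1 2 3 by (intro conjI)
  then show thesis by (rule that)
qed

lemma combine_N_stable:
  assumes "int (card N) = 3" "x \<in> N" "y \<in> N" "completes x e" "completes y f" "e \<noteq> f" "x \<noteq> y"
    and "\<not> disjoint_rainbow_cuts H T c n"
  shows "int n + 2 \<le> d x + d y"
  using combine[OF assms(2-6) N_stable[OF assms(1-3,7)]] assms(8) unfolding d_def by linarith

lemma card_st_pos_sides:
  assumes "v \<in> verts H" "x \<in> A" "y \<in> A" "x \<noteq> y" "z \<in> verts H - A" "w \<in> verts H - A" "z \<noteq> w"
  shows "1 \<le> d v"
proof (rule card_st_pos[OF assms(1)])
  show "{v} \<noteq> A" using assms(2-4) by auto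
  show "{v} \<noteq> verts H - A" using assms(5-7) by (metis singletonD)
qed

text \<open>The pairs on opposite sides completed by different edges form a hexagon on
  \<open>VT\<close>, and each such pair inside \<open>N\<close> has degree sum at least n +
  2.\<close>

lemma conclusion_matching:
  assumes lab: "labelled e1 a1 b1 e2 a2 b2 e3 a3 b3"
    and a: "a1 \<noteq> a2" "a1 \<noteq> a3" "a2 \<noteq> a3" and b: "b1 \<noteq> b2" "b1 \<noteq> b3" "b2 \<noteq> b3"
  shows "disjoint_rainbow_cuts H T c n"
proof (rule ccontr)
  assume no: "\<not> ?thesis"
  have T: "T = {e1, e2, e3}" "e1 \<noteq> e2" "e1 \<noteq> e3" "e2 \<noteq> e3"
    and ends: "ends H e1 = {a1, b1}" "ends H e2 = {a2, b2}" "ends H e3 = {a3, b3}"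
    and A: "a1 \<in> A" "a2 \<in> A" "a3 \<in> A"
    and B: "b1 \<in> verts H" "b2 \<in> verts H" "b3 \<in> verts H" "b1 \<notin> A" "b2 \<notin> A" "b3 \<notin> A"
    using lab by (auto simp: labelled_def)
  have ab: "a1 \<noteq> b1" "a1 \<noteq> b2" "a1 \<noteq> b3" "a2 \<noteq> b1" "a2 \<noteq> b2" "a2 \<noteq> b3" "a3 \<noteq> b1" "a3 \<noteq> b2" "a3 \<noteq> b3"
    using A B by blast+
  have AV: "a1 \<in> verts H" "a2 \<in> verts H" "a3 \<in> verts H" using A A_verts by blast+
  have VT: "VT = {a1, a2, a3, b1, b2, b3}" unfolding VT_def unfolding T(1) using ends by auto
  have completes: "completes a1 e1" "completes a2 e2" "completes a3 e3"
    "completes b1 e1" "completes b2 e2" "completes b3 e3"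
    by (rule completes_single; use T ends A B AV ab a b in auto)+
  have pos: "1 \<le> d v" if "v \<in> verts H" for v
    using card_st_pos_sides[OF that A(1,2) a(1), of b1 b2] B b by simp
  have cardVT: "card VT = 6" unfolding VT using a b ab by simp
  have S: "(\<Sum>v\<in>VT. if v \<in> N then d v else 0) + 3 \<le> int n + 2 * int (card N)"
    using sum_d_over_VT cardVT by simp
  have Ss: "(\<Sum>v\<in>VT. if v \<in> N then d v else 0) =
     (if a1 \<in> N then d a1 else 0) + (if a2 \<in> N then d a2 else 0) + (if a3 \<in> N then d a3 else 0) +
     (if b1 \<in> N then d b1 else 0) + (if b2 \<in> N then d b2 else 0) + (if b3 \<in> N then d b3 else 0)"
    unfolding VT using a b ab by simp
  have m: "int (card N) = (if a1 \<in> N then 1 else 0) + (if a2 \<in> N then 1 else 0) + (if a3 \<in> N then 1 else 0) +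
     (if b1 \<in> N then 1 else 0) + (if b2 \<in> N then 1 else 0) + (if b3 \<in> N then 1 else 0)"
    unfolding card_N_over_VT unfolding VT using a b ab by simp
  note cross =
    combine_sides[OF _ _ completes(1,5) T(2) A(1) B(5) no]
    combine_sides[OF _ _ completes(1,6) T(3) A(1) B(6) no]
    combine_sides[OF _ _ completes(2,4) T(2)[symmetric] A(2) B(4) no]
    combine_sides[OF _ _ completes(2,6) T(4) A(2) B(6) no]
    combine_sides[OF _ _ completes(3,4) T(3)[symmetric] A(3) B(4) no]
    combine_sides[OF _ _ completes(3,5) T(4)[symmetric] A(3) B(5) no]
  note stable =
    combine_N_stable[OF _ _ _ completes(1,2) T(2) a(1) no]
    combine_N_stable[OF _ _ _ completes(1,3) T(3) a(2) no]
    combine_N_stable[OF _ _ _ completes(2,3) T(4) a(3) no]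
    combine_N_stable[OF _ _ _ completes(4,5) T(2) b(1) no]
    combine_N_stable[OF _ _ _ completes(4,6) T(3) b(2) no]
    combine_N_stable[OF _ _ _ completes(5,6) T(4) b(3) no]
  note common =
    completes_common[OF _ _ _ A(1) B(4) completes(1,4) pos[OF AV(1)]]
    completes_common[OF _ _ _ A(2) B(5) completes(2,5) pos[OF AV(2)]]
    completes_common[OF _ _ _ A(3) B(6) completes(3,6) pos[OF AV(3)]]
  have le: "v \<in> N \<Longrightarrow> d v \<le> int n" for v by (rule d_le)
  have lessA: "v \<in> N \<Longrightarrow> v \<in> A \<Longrightarrow> int (card N) = 4 \<Longrightarrow> d v + 1 \<le> int n" for v
    by (rule card_st_less[OF _ _ b]) (use B pos in auto)
  have lessB: "v \<in> N \<Longrightarrow> v \<notin> A \<Longrightarrow> int (card N) = 4 \<Longrightarrow> d v + 1 \<le> int n" for v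
    by (rule card_st_less[OF _ _ a]) (use A AV pos in auto)
  have less: "int (card N) = 4 \<Longrightarrow> a1 \<in> N \<Longrightarrow> d a1 + 1 \<le> int n" "int (card N) = 4 \<Longrightarrow> a2 \<in> N \<Longrightarrow> d a2 + 1 \<le> int n"
    "int (card N) = 4 \<Longrightarrow> a3 \<in> N \<Longrightarrow> d a3 + 1 \<le> int n" "int (card N) = 4 \<Longrightarrow> b1 \<in> N \<Longrightarrow> d b1 + 1 \<le> int n"
    "int (card N) = 4 \<Longrightarrow> b2 \<in> N \<Longrightarrow> d b2 + 1 \<le> int n" "int (card N) = 4 \<Longrightarrow> b3 \<in> N \<Longrightarrow> d b3 + 1 \<le> int n"
    using lessA lessB A B by blast+
  have n3: "3 \<le> int n" using card_VT_le cardVT by simp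
  note facts = S[unfolded Ss] m cross stable common less card_N_ge n3
    le[of a1] le[of a2] le[of a3] le[of b1] le[of b2] le[of b3]
    pos[OF AV(1)] pos[OF AV(2)] pos[OF AV(3)] pos[OF B(1)] pos[OF B(2)] pos[OF B(3)]
  \<comment> \<open>Let m = |N|; the degree sum on \<open>N\<close> is at most n + 2m - 3. For m = 3
    all three pairs reach n + 2. For m = 4 the hexagon has two disjoint pairs in \<open>N\<close>,
    or \<open>N\<close> is one side plus a vertex of degree at most n - 1; its two neighbours in the
    hexagon then have degree at least 3, and the sum is at least (n + 2) + 3 + 1. For m = 5 there
    are two disjoint pairs and one more vertex, for m = 6 three disjoint pairs; n >= 3
    suffices.\<close>
  show False
    using facts
    by (smt (verit))
qed

lemma conclusion_cherry_edge:
  assumes lab: "labelled e1 a b1 e2 a b2 e3 a' b3"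
    and a: "a \<noteq> a'" and b: "b1 \<noteq> b2" "b1 \<noteq> b3" "b2 \<noteq> b3"
  shows "disjoint_rainbow_cuts H T c n"
proof (rule ccontr)
  assume no: "\<not> ?thesis"
  have T: "T = {e1, e2, e3}" "e1 \<noteq> e2" "e1 \<noteq> e3" "e2 \<noteq> e3"
    and ends: "ends H e1 = {a, b1}" "ends H e2 = {a, b2}" "ends H e3 = {a', b3}"
    and A: "a \<in> A" "a' \<in> A"
    and B: "b1 \<in> verts H" "b2 \<in> verts H" "b3 \<in> verts H" "b1 \<notin> A" "b2 \<notin> A" "b3 \<notin> A"
    using lab by (auto simp: labelled_def)
  have ab: "a \<noteq> b1" "a \<noteq> b2" "a \<noteq> b3" "a' \<noteq> b1" "a' \<noteq> b2" "a' \<noteq> b3"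
    using A B by blast+
  have AV: "a \<in> verts H" "a' \<in> verts H" using A A_verts by blast+
  have VT: "VT = {a, a', b1, b2, b3}" unfolding VT_def unfolding T(1) using ends by auto
  have completes: "completes a' e3" "completes b1 e1" "completes b2 e2" "completes b3 e3"
    by (rule completes_single; use T ends A B AV ab a b in auto)+
  have completes': "completes a e3"
    by (rule completes_double; use T ends A B AV ab a b in auto)
  have pos: "1 \<le> d v" if "v \<in> verts H" for v
    using card_st_pos_sides[OF that A(1,2) a(1), of b1 b2] B b by simp
  have cardVT: "card VT = 5" unfolding VT using a b ab by simp
  have S: "(\<Sum>v\<in>VT. if v \<in> N then d v else 0) + 4 \<le> int n + 2 * int (card N)"
    using sum_d_over_VT cardVT by simp
  have Ss: "(\<Sum>v\<in>VT. if v \<in> N then d v else 0) =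
     (if a \<in> N then d a else 0) + (if a' \<in> N then d a' else 0) +
     (if b1 \<in> N then d b1 else 0) + (if b2 \<in> N then d b2 else 0) + (if b3 \<in> N then d b3 else 0)"
    unfolding VT using a b ab by simp
  have m: "int (card N) = (if a \<in> N then 1 else 0) + (if a' \<in> N then 1 else 0) +
     (if b1 \<in> N then 1 else 0) + (if b2 \<in> N then 1 else 0) + (if b3 \<in> N then 1 else 0)"
    unfolding card_N_over_VT unfolding VT using a b ab by simp
  note cross =
    combine_sides[OF _ _ completes' completes(2) T(3)[symmetric] A(1) B(4) no]
    combine_sides[OF _ _ completes' completes(3) T(4)[symmetric] A(1) B(5) no]
    combine_sides[OF _ _ completes(1) completes(2) T(3)[symmetric] A(2) B(4) no]
    combine_sides[OF _ _ completes(1) completes(3) T(4)[symmetric] A(2) B(5) no]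
  note stable =
    combine_N_stable[OF _ _ _ completes(2,3) T(2) b(1) no]
    combine_N_stable[OF _ _ _ completes(2,4) T(3) b(2) no]
    combine_N_stable[OF _ _ _ completes(3,4) T(4) b(3) no]
  note common =
    completes_common[OF _ _ _ A(1) B(6) completes' completes(4) pos[OF AV(1)]]
    completes_common[OF _ _ _ A(2) B(6) completes(1,4) pos[OF AV(2)]]
  have le: "v \<in> N \<Longrightarrow> d v \<le> int n" for v by (rule d_le)
  have n3: "2 \<le> int n" using card_VT_le cardVT by simp
  note facts = S[unfolded Ss] m cross stable common card_N_ge n3
    le[of a] le[of a'] le[of b1] le[of b2] le[of b3]
    pos[OF AV(1)] pos[OF AV(2)] pos[OF B(1)] pos[OF B(2)] pos[OF B(3)]
  \<comment> \<open>The degree sum on \<open>N\<close> is at most n + 2|N| - 4. If |N| = 3, all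
    three pairs reach n + 2, or \<open>N\<close> consists of \<open>a\<close>, \<open>a'\<close> and
    one of \<open>b1\<close>, \<open>b2\<close>, with sum at least n + 3. If |N| = 4, there are two
    disjoint pairs, or two pairs sharing a vertex of degree at most n, which force (n + 2) + 2 + 1.
    If |N| = 5, the sum is at least 2n + 5, and n >= 2.\<close>
  show False
    using facts
    by (smt (verit))
qed

lemma conclusion_path:
  assumes lab: "labelled e1 a b e2 a b' e3 a' b'" and a: "a \<noteq> a'" and b: "b \<noteq> b'"
  shows "disjoint_rainbow_cuts H T c n"
proof (rule ccontr)
  assume no: "\<not> ?thesis"
  have T: "T = {e1, e2, e3}" "e1 \<noteq> e2" "e1 \<noteq> e3" "e2 \<noteq> e3"
    and ends: "ends H e1 = {a, b}" "ends H e2 = {a, b'}" "ends H e3 = {a', b'}"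
    and A: "a \<in> A" "a' \<in> A"
    and B: "b \<in> verts H" "b' \<in> verts H" "b \<notin> A" "b' \<notin> A"
    using lab by (auto simp: labelled_def)
  have ab: "a \<noteq> b" "a \<noteq> b'" "a' \<noteq> b" "a' \<noteq> b'" using A B by blast+
  have AV: "a \<in> verts H" "a' \<in> verts H" using A A_verts by blast+
  have VT: "VT = {a, a', b, b'}" unfolding VT_def unfolding T(1) using ends by auto
  have completes: "completes a' e3" "completes b e1"
    by (rule completes_single; use T ends A B AV ab a b in auto)+
  have completes': "completes a e3" "completes b' e1"
    by (rule completes_double; use T ends A B AV ab a b in auto)+
  have cardVT: "card VT = 4" unfolding VT using a b ab by simp
  have S: "(\<Sum>v\<in>VT. if v \<in> N then d v else 0) + 5 \<le> int n + 2 * int (card N)"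
    using sum_d_over_VT cardVT by simp
  have Ss: "(\<Sum>v\<in>VT. if v \<in> N then d v else 0) =
     (if a \<in> N then d a else 0) + (if a' \<in> N then d a' else 0) +
     (if b \<in> N then d b else 0) + (if b' \<in> N then d b' else 0)"
    unfolding VT using a b ab by simp
  have m: "int (card N) = (if a \<in> N then 1 else 0) + (if a' \<in> N then 1 else 0) + (if b \<in> N then 1 else 0) + (if b' \<in> N then 1 else 0)"
    unfolding card_N_over_VT unfolding VT using a b ab by simp
  note cross =
    combine_sides[OF _ _ completes'(1) completes(2) T(3)[symmetric] A(1) B(3) no]
    combine_sides[OF _ _ completes'(1) completes'(2) T(3)[symmetric] A(1) B(4) no]
    combine_sides[OF _ _ completes(1) completes(2) T(3)[symmetric] A(2) B(3) no]
    combine_sides[OF _ _ completes(1) completes'(2) T(3)[symmetric] A(2) B(4) no]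
  \<comment> \<open>Every pair on opposite sides is admissible. One pair gives n + 2 against n + 1
    if |N| = 3, two disjoint pairs give 2n + 4 against n + 3 if |N| = 4.\<close>
  show False
    using S[unfolded Ss] m cross card_N_ge colours_pos' d_nonneg[of a] d_nonneg[of a'] d_nonneg[of b] d_nonneg[of b']
    by (smt (verit))
qed

section \<open>The star, where the admissible pairs lie on one side\<close>

lemma two_neighbours:
  assumes "st x \<inter> st y \<noteq> {}" "st x \<inter> st z \<noteq> {}" "x \<noteq> y" "x \<noteq> z" "y \<noteq> z"
  shows "2 \<le> d x"
proof -
  obtain e f where e: "e \<in> st x" "e \<in> st y" and f: "f \<in> st x" "f \<in> st z" using assms(1,2) by blast
  have "ends H e = {x, y}" "ends H f = {x, z}" using st_ends e f assms(3,4) by blast+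
  then have "e \<noteq> f" using assms(3-5) by (auto simp: doubleton_eq_iff)
  then show ?thesis using card_mono[OF finite_st[of x], of "{e, f}"] e f by (simp add: d_def)
qed

text \<open>Edges inside \<open>N\<close> have a left-over colour. There is only one, and its class
  has two edges, not three.\<close>

lemma no_triangle:
  assumes "int (card N) = 4" "x \<in> N" "y \<in> N" "z \<in> N" "x \<noteq> y" "x \<noteq> z" "y \<noteq> z"
    and "st x \<inter> st y \<noteq> {}" "st x \<inter> st z \<noteq> {}" "st y \<inter> st z \<noteq> {}"
  shows False
proof -
  obtain Bad where Bad: "card Bad + 3 = card N" "finite Bad"
    "\<forall>e\<in>edges H - T. c e \<notin> Bad \<longrightarrow> (\<exists>v\<in>verts H - N. {f\<in>edges H - T. c f = c e} \<subseteq> st v)"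
    by (rule card_noncentres)
  have bad: "c e \<in> Bad" if e: "e \<in> st p" "e \<in> st q" "p \<in> N" "q \<in> N" "p \<noteq> q" for e p q
  proof (rule ccontr)
    assume "c e \<notin> Bad"
    moreover have E: "e \<in> edges H - T" using e(1) st_subset by blast
    ultimately obtain v where v: "v \<in> verts H - N" "{f\<in>edges H - T. c f = c e} \<subseteq> st v"
      using bspec[OF Bad(3) E] by blast
    then have "e \<in> st v" using E by blast
    then show False using st_end[of e v] st_ends[OF e(1,2,5)] v(1) e(3,4) by auto
  qed
  obtain e f h where e: "e \<in> st x" "e \<in> st y" and f: "f \<in> st x" "f \<in> st z" and h: "h \<in> st y" "h \<in> st z"
    using assms(8-10) by blast
  have ends: "ends H e = {x, y}" "ends H f = {x, z}" "ends H h = {y, z}"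
    using st_ends e f h assms(5-7) by blast+
  then have ne: "e \<noteq> f" "e \<noteq> h" "f \<noteq> h" using assms(5-7) by (auto simp: doubleton_eq_iff)
  have "c e \<in> Bad" "c f \<in> Bad" "c h \<in> Bad"
    using bad[OF e assms(2,3,5)] bad[OF f assms(2,4,6)] bad[OF h assms(3,4,7)] .
  moreover have "card Bad = 1" using Bad(1) assms(1) by simp
  ultimately have "c f = c e" "c h = c e" by (auto simp: card_1_singleton_iff)
  then have "{e, f, h} \<subseteq> {k\<in>edges H - T. c k = c e}" "card {e, f, h} = 3"
    using e f h ne st_subset[of x] st_subset[of y] by auto
  then have "3 \<le> card {k\<in>edges H - T. c k = c e}"
    using card_mono[of "{k\<in>edges H - T. c k = c e}" "{e, f, h}"] finite_edges by simp
  then show False using card_class[of e] e(1) st_subset[of x] by fastforce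
qed

text \<open>The pair would be joined only to each other outside \<open>T\<close>, so its cut lies in
  \<open>T\<close> and the pair is a full side; but \<open>z\<close> also lies in
  \<open>A\<close>.\<close>

lemma no_isolated_pair:
  assumes "x \<in> A" "y \<in> A" "z \<in> A" "x \<noteq> y" "x \<noteq> z" "y \<noteq> z"
    and "d x = 1" "d y = 1" "st x \<inter> st y \<noteq> {}"
  shows False
proof -
  obtain e where e: "e \<in> st x" "e \<in> st y" using assms(9) by blast
  have st: "st x = {e}" "st y = {e}" using assms(7,8) e by (auto simp: d_def card_1_singleton_iff)
  have ends: "ends H e = {x, y}" using st_ends e assms(4) by blast
  have "edge_cut H {x, y} \<subseteq> T"
  proof
    fix f assume f: "f \<in> edge_cut H {x, y}"
    show "f \<in> T"
    proof (rule ccontr)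
      assume "f \<notin> T"
      have fE: "f \<in> edges H" using f cut_subset[of H] by blast
      obtain p q where pq: "ends H f = {p, q}" by (rule graph_ends[OF graph_H fE])
      have cut1: "(p \<in> {x, y}) \<noteq> (q \<in> {x, y})" by (rule iffD1[OF cut_iff[OF fE pq] f])
      then have "card (ends H f) = 2" unfolding pq by (cases "p = q") simp_all
      moreover have "x \<in> ends H f \<or> y \<in> ends H f" using cut1 unfolding pq by auto
      ultimately have "f \<in> st x \<union> st y" using fE \<open>f \<notin> T\<close> by (auto simp: st_def edge_star_def)
      then have "f = e" using st by blast
      then show False using f ends by (simp add: edge_cut_def)
    qed
  qed
  moreover have "{x, y} \<subseteq> verts H" using assms(1,2) A_verts by blast
  ultimately have "{x, y} \<in> {{}, verts H, A, verts H - A}" by (intro cut_within_T)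
  moreover have "{x, y} \<noteq> verts H" "{x, y} \<noteq> A" using assms(3,5,6) A_verts by auto
  moreover have "{x, y} \<noteq> verts H - A" using assms(1) by blast
  ultimately show False by simp
qed

text \<open>The centre \<open>b\<close> meets all of \<open>T\<close>, so the completion lemmas give
  nothing for it. The pairs must be leaves, whose stars can overlap; adjacency among them has to be
  controlled.\<close>

lemma conclusion_star:
  assumes lab: "labelled e1 a1 b e2 a2 b e3 a3 b"
    and a: "a1 \<noteq> a2" "a1 \<noteq> a3" "a2 \<noteq> a3"
  shows "disjoint_rainbow_cuts H T c n"
proof (rule ccontr)
  assume no: "\<not> ?thesis"
  have T: "T = {e1, e2, e3}" "e1 \<noteq> e2" "e1 \<noteq> e3" "e2 \<noteq> e3"
    and ends: "ends H e1 = {a1, b}" "ends H e2 = {a2, b}" "ends H e3 = {a3, b}"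
    and A: "a1 \<in> A" "a2 \<in> A" "a3 \<in> A" and B: "b \<in> verts H" "b \<notin> A"
    using lab by (auto simp: labelled_def)
  have ab: "a1 \<noteq> b" "a2 \<noteq> b" "a3 \<noteq> b" using A B by blast+
  have AV: "a1 \<in> verts H" "a2 \<in> verts H" "a3 \<in> verts H" using A A_verts by blast+
  have VT: "VT = {a1, a2, a3, b}" unfolding VT_def unfolding T(1) using ends by auto
  have completes: "completes a1 e1" "completes a2 e2" "completes a3 e3"
    by (rule completes_single; use T ends A B AV ab a in auto)+
  have pos: "1 \<le> d v" if "v \<in> A" for v
  proof (rule card_st_pos)
    show "v \<in> verts H" using that A_verts by blast
    show "{v} \<noteq> A" using A a(1) by blast
    show "{v} \<noteq> verts H - A" using that by blast
  qed
  have cardVT: "card VT = 4" unfolding VT using a ab by simp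
  have S: "(\<Sum>v\<in>VT. if v \<in> N then d v else 0) + 5 \<le> int n + 2 * int (card N)"
    using sum_d_over_VT cardVT by simp
  have Ss: "(\<Sum>v\<in>VT. if v \<in> N then d v else 0) =
     (if a1 \<in> N then d a1 else 0) + (if a2 \<in> N then d a2 else 0) + (if a3 \<in> N then d a3 else 0) +
     (if b \<in> N then d b else 0)"
    unfolding VT using a ab by simp
  have m: "int (card N) = (if a1 \<in> N then 1 else 0) + (if a2 \<in> N then 1 else 0) + (if a3 \<in> N then 1 else 0) + (if b \<in> N then 1 else 0)"
    unfolding card_N_over_VT unfolding VT using a ab by simp
  note stable =
    combine_N_stable[OF _ _ _ completes(1,2) T(2) a(1) no]
    combine_N_stable[OF _ _ _ completes(1,3) T(3) a(2) no]
    combine_N_stable[OF _ _ _ completes(2,3) T(4) a(3) no]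
  \<comment> \<open>With |N| = 3 at least two leaves lie in \<open>N\<close>; their degree sum n + 2
    exceeds the bound n + 1.\<close>
  have four: "int (card N) = 4"
    using S[unfolded Ss] m stable card_N_ge d_nonneg[of a1] d_nonneg[of a2] d_nonneg[of a3] d_nonneg[of b]
    by (smt (verit))
  then have aN: "a1 \<in> N" "a2 \<in> N" "a3 \<in> N" using m by (auto simp: split: if_splits)
  have S3: "d a1 + d a2 + d a3 \<le> int n + 3" using S[unfolded Ss] aN four d_nonneg[of b] by (simp split: if_splits)
  have disj: "int n + 2 \<le> d a1 + d a2" if "st a1 \<inter> st a2 = {}"
    using combine[OF aN(1,2) completes(1,2) T(2) that] no unfolding d_def by linarith
  have disj': "int n + 2 \<le> d a1 + d a3" if "st a1 \<inter> st a3 = {}"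
    using combine[OF aN(1,3) completes(1,3) T(3) that] no unfolding d_def by linarith
  have disj'': "int n + 2 \<le> d a2 + d a3" if "st a2 \<inter> st a3 = {}"
    using combine[OF aN(2,3) completes(2,3) T(4) that] no unfolding d_def by linarith
  note tri = no_triangle[OF four aN a]
  note iso = no_isolated_pair[OF A a] no_isolated_pair[OF A(1,3,2) a(2,1) a(3)[symmetric]]
    no_isolated_pair[OF A(2,3,1) a(3) a(1,2)[symmetric]]
  note nb = two_neighbours[of a1 a2 a3, OF _ _ a]
    two_neighbours[of a2 a1 a3, OF _ _ a(1)[symmetric] a(3,2)]
    two_neighbours[of a3 a1 a2, OF _ _ a(2,3)[symmetric] a(1)]
  note p = pos[OF A(1)] pos[OF A(2)] pos[OF A(3)]
  have comm: "st a2 \<inter> st a1 = st a1 \<inter> st a2" "st a3 \<inter> st a1 = st a1 \<inter> st a3"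
    "st a3 \<inter> st a2 = st a2 \<inter> st a3" by blast+
  \<comment> \<open>Some pair of leaves is disjoint, so by \<open>S3\<close> the third leaf has
    degree 1 and is adjacent to at most one of them. Being disjoint from another leaf, it forces
    degree 1 on the remaining one; these two are then an isolated pair, or all three degrees are too
    small.\<close>
  show False
    using tri iso nb[unfolded comm] p S3 disj disj' disj'' colours_pos'
    by (smt (verit))
qed

text \<open>With digons excluded, the two edges at \<open>a\<close> form a cherry; the third edge
  either ends at one of its leaves, giving a path, or misses it.\<close>

lemma conclusion_two_equal:
  assumes lab: "labelled e1 a b1 e2 a b2 e3 a' b3" and a: "a \<noteq> a'"
  shows "disjoint_rainbow_cuts H T c n"
proof -
  have "b1 \<noteq> b2" using lab not_parallel_in_T[of e1 e2] unfolding labelled_def by auto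
  then consider "b1 \<noteq> b3" "b2 \<noteq> b3" | "b2 = b3" | "b1 = b3" by blast
  then show ?thesis
  proof cases
    case 1
    then show ?thesis using conclusion_cherry_edge[OF lab a] \<open>b1 \<noteq> b2\<close> by blast
  next
    case 2
    then show ?thesis using conclusion_path[of e1 a b1 e2 b3] lab a \<open>b1 \<noteq> b2\<close> by simp
  next
    case 3
    then show ?thesis
      using conclusion_path[of e2 a b2 e1 b3] labelled_swap12[OF lab] a \<open>b1 \<noteq> b2\<close> by simp
  qed
qed

text \<open>Coincidences are sought first among the ends in \<open>A\<close>, then among the others;
  the copy \<open>s\<close> with exchanged sides covers a star centred in \<open>A\<close> and
  cherries centred outside \<open>A\<close>.\<close>

theorem reduced_conclusion: "disjoint_rainbow_cuts H T c n"
proof -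
  obtain e1 a1 b1 e2 a2 b2 e3 a3 b3 where lab: "labelled e1 a1 b1 e2 a2 b2 e3 a3 b3"
    by (rule obtain_labelled)
  interpret s: reduced_bond_split H T "verts H - A" c n by (rule swap)
  note l = lab labelled_swap23[OF lab] labelled_swap23[OF labelled_swap12[OF lab]]
  note s = l[THEN labelled_sides]
  have T: "e1 \<in> T" "e2 \<in> T" "e3 \<in> T" "e1 \<noteq> e2" "e1 \<noteq> e3" "e2 \<noteq> e3"
    and ends: "ends H e1 = {a1, b1}" "ends H e2 = {a2, b2}" "ends H e3 = {a3, b3}"
    using lab by (auto simp: labelled_def)
  have np: "\<not> (a1 = a2 \<and> b1 = b2)" "\<not> (a1 = a3 \<and> b1 = b3)" "\<not> (a2 = a3 \<and> b2 = b3)"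
    using not_parallel_in_T[OF T(1,2,4)] not_parallel_in_T[OF T(1,3,5)] not_parallel_in_T[OF T(2,3,6)] ends
    by auto
  consider "a1 = a2" "a2 = a3" | "a1 = a2" "a2 \<noteq> a3" | "a1 = a3" "a1 \<noteq> a2" | "a2 = a3" "a1 \<noteq> a2"
    | "a1 \<noteq> a2" "a1 \<noteq> a3" "a2 \<noteq> a3" by blast
  then show ?thesis
  proof cases
    case 1
    then show ?thesis using s.conclusion_star[of e1 b1 a3 e2 b2 e3 b3] s(1) np by simp
  next
    case 2
    then show ?thesis using conclusion_two_equal[of e1 a2 b1 e2 b2 e3 a3 b3] l(1) by simp
  next
    case 3
    then show ?thesis using conclusion_two_equal[of e1 a3 b1 e3 b3 e2 a2 b2] l(2) by simp
  next
    case 4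
    then show ?thesis using conclusion_two_equal[of e2 a3 b2 e3 b3 e1 a1 b1] l(3) by simp
  next
    case 5
    consider "b1 = b2" "b2 = b3" | "b1 = b2" "b2 \<noteq> b3" | "b1 = b3" "b1 \<noteq> b2" | "b2 = b3" "b1 \<noteq> b2"
      | "b1 \<noteq> b2" "b1 \<noteq> b3" "b2 \<noteq> b3" by blast
    then show ?thesis
    proof cases
      case 1
      then show ?thesis using conclusion_star[of e1 a1 b3 e2 a2 e3 a3] l(1) 5 by simp
    next
      case 2
      then show ?thesis using s.conclusion_two_equal[of e1 b2 a1 e2 a2 e3 b3 a3] s(1) by simp
    next
      case 3
      then show ?thesis using s.conclusion_two_equal[of e1 b3 a1 e3 a3 e2 b2 a2] s(2) by simp
    next
      case 4
      then show ?thesis using s.conclusion_two_equal[of e2 b3 a2 e3 a3 e1 b1 a1] s(3) by simp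
    next
      case inner: 5
      then show ?thesis using conclusion_matching[OF lab] 5 by blast
    qed
  qed
qed

end

section \<open>Contracting parallel colour classes\<close>

text \<open>The class consists of exactly the two parallel edges, so one colour and one vertex
  disappear while all other classes and \<open>T\<close> stay intact.\<close>

lemma bond_split_contract_parallel:
  assumes "bond_split H T A c (Suc n)"
    and ef: "e \<in> edges H - T" "f \<in> edges H - T" "e \<noteq> f" "c e = c f" "ends H e = ends H f"
    and uw: "ends H e = {u, w}" "u \<noteq> w"
    and \<phi>: "\<phi> = id(w := u)" and F: "F = T \<union> {h\<in>edges H - T. c h \<noteq> c e}"
  shows "bond_split (quotient_graph H \<phi> F) T (\<phi> ` A) c n"
    and "edge_cut (quotient_graph H \<phi> F) X = edge_cut H {v\<in>verts H. \<phi> v \<in> X}"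
proof -
  interpret bond_split H T A c "Suc n" by fact
  let ?Q = "quotient_graph H \<phi> F" and ?P = "\<lambda>X. {v\<in>verts H. \<phi> v \<in> X}"
  have eE: "e \<in> edges H" using ef(1) by simp
  have uwV: "u \<in> verts H" "w \<in> verts H" using uw(1) graph_H eE by (auto simp: graph_def)
  have cls: "{h\<in>edges H - T. c h = c e} = {e, f}"
    using card_seteq[of "{h\<in>edges H - T. c h = c e}" "{e, f}"] card_class[OF ef(1)] finite_edges ef by auto
  have FE: "F \<subseteq> edges H" using T_edges by (auto simp: F)
  have cq: "edge_cut ?Q X = edge_cut H (?P X)" for X
  proof (rule cut_quotient[OF graph_H FE])
    fix h x y assume h: "h \<in> edges H - F" "x \<in> ends H h" "y \<in> ends H h"
    then have "h \<in> {h\<in>edges H - T. c h = c e}" by (auto simp: F)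
    then have "h \<in> {e, f}" unfolding cls .
    then have "ends H h = {u, w}" using ef(5) uw(1) by auto
    then show "\<phi> x = \<phi> y" using h(2,3) by (auto simp: \<phi>)
  qed
  show "edge_cut ?Q X = edge_cut H (?P X)" by (rule cq)
  \<comment> \<open>As \<open>e\<close> is not in \<open>T\<close>, both its ends are on one side;
    hence \<open>A\<close> is a union of fibres of \<open>\<phi>\<close>.\<close>
  have "e \<notin> edge_cut H A" using ef(1) cut_A by simp
  then have side: "u \<in> A \<longleftrightarrow> w \<in> A" using cut_iff[OF eE uw(1)] by simp
  have preA: "?P (\<phi> ` A) = A" using side A_verts by (auto simp: \<phi> split: if_splits)
  have FT: "edges ?Q - T = {h\<in>edges H - T. c h \<noteq> c e}" by (auto simp: F)
  have imgV: "\<phi> ` verts H = verts H - {w}" using uwV uw(2) by (auto simp: \<phi>)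
  show "bond_split ?Q T (\<phi> ` A) c n"
  proof
    show "graph ?Q" by (rule graph_quotient[OF graph_H FE])
    show "T \<subseteq> edges ?Q" by (simp add: F)
    show "card T = 3" by (rule card_T)
    show "card (verts ?Q) = n + 3" using imgV uwV(2) card_verts finite_verts by simp
    show "\<phi> ` A \<subseteq> verts ?Q" using A_verts by auto
    show "edge_cut ?Q (\<phi> ` A) = T" unfolding cq preA by (rule cut_A)
    show "X \<in> {{}, verts ?Q, \<phi> ` A, verts ?Q - \<phi> ` A}" if X: "X \<subseteq> verts ?Q" "edge_cut ?Q X \<subseteq> T" for X
    proof -
      define Y where "Y = ?P X"
      \<comment> \<open>For a non-injective map this needs \<open>preA\<close>: no vertex outside
        \<open>A\<close> has its image in that of \<open>A\<close>.\<close>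
      have img: "\<phi> ` (verts H - A) = \<phi> ` verts H - \<phi> ` A"
      proof
        show "\<phi> ` (verts H - A) \<subseteq> \<phi> ` verts H - \<phi> ` A"
        proof (rule image_subsetI)
          fix v assume v: "v \<in> verts H - A"
          then have "v \<notin> ?P (\<phi> ` A)" unfolding preA by simp
          then show "\<phi> v \<in> \<phi> ` verts H - \<phi> ` A" using v by simp
        qed
      qed blast
      have "edge_cut H Y \<subseteq> T" using X(2) unfolding cq Y_def .
      then have "Y \<in> {{}, verts H, A, verts H - A}" by (intro cut_within_T) (auto simp: Y_def)
      then have "\<phi> ` Y \<in> {{}, \<phi> ` verts H, \<phi> ` A, \<phi> ` verts H - \<phi> ` A}"
        unfolding img[symmetric] by (elim insertE emptyE) simp_all
      moreover have "\<phi> ` Y = X" using X(1) by (auto simp: Y_def)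
      ultimately show ?thesis by simp
    qed
    have "c ` (edges ?Q - T) = c ` (edges H - T) - {c e}" unfolding FT by auto
    moreover have "c e \<in> c ` (edges H - T)" using ef(1) by simp
    ultimately show "card (c ` (edges ?Q - T)) = n" using card_colours finite_edges by simp
    show "card {g\<in>edges ?Q - T. c g = c h} = 2" if h: "h \<in> edges ?Q - T" for h
    proof -
      have "{g\<in>edges ?Q - T. c g = c h} = {g\<in>edges H - T. c g = c h}" "h \<in> edges H - T"
        using h unfolding FT by auto
      then show ?thesis using card_class[of h] by simp
    qed
    show "3 \<le> card (edge_cut ?Q X) \<and> \<not> inj_on c (edge_cut ?Q X)"
      if X: "X \<subseteq> verts ?Q" "X \<noteq> {}" "X \<noteq> verts ?Q" "edge_cut ?Q X \<inter> T = {}" for X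
    proof -
      have X1: "X \<subseteq> \<phi> ` verts H" using X(1) by simp
      have "?P X \<noteq> {}" "?P X \<noteq> verts H"
        using X(2,3) by (simp_all only: quotient_preimage_trivial[OF X1] quotient_simps simp_thms)
      moreover have "?P X \<subseteq> verts H" by blast
      ultimately show ?thesis using cut_avoiding_T[of "?P X"] X(4) unfolding cq by simp
    qed
  qed
qed

text \<open>Induction on the number of colours. A contraction yields cuts even within n + 3, one
  below what is required.\<close>

lemma bond_split_conclusion:
  assumes "bond_split H T A c n"
  shows "disjoint_rainbow_cuts H T c n"
  using assms
proof (induction n arbitrary: H A)
  case 0
  then show ?case using bond_split.colours_pos by fastforce
next
  case (Suc n)
  interpret bond_split H T A c "Suc n" by (rule Suc.prems)
  show ?case
  proof (cases "parallel_free H (edges H - T) c")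
    case True
    then have "reduced_bond_split H T A c (Suc n)"
      using Suc.prems by (simp add: reduced_bond_split_def reduced_bond_split_axioms_def)
    then show ?thesis by (rule reduced_bond_split.reduced_conclusion)
  next
    case False
    then obtain e f where ef: "e \<in> edges H - T" "f \<in> edges H - T" "e \<noteq> f" "c e = c f"
      "ends H e = ends H f" "card (ends H e) = 2" unfolding parallel_free_def by blast
    obtain u w where uw: "ends H e = {u, w}" "u \<noteq> w" using ef(6) by (auto simp: card_2_iff)
    define \<phi> where "\<phi> = id(w := u)"
    define F where "F = T \<union> {h\<in>edges H - T. c h \<noteq> c e}"
    let ?Q = "quotient_graph H \<phi> F" and ?P = "\<lambda>X. {v\<in>verts H. \<phi> v \<in> X}"
    note contract = bond_split_contract_parallel[OF Suc.prems ef(1-5) uw \<phi>_def F_def]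
    obtain X Y e' f' where XY: "X \<subseteq> verts ?Q" "Y \<subseteq> verts ?Q" "e' \<noteq> f'"
      "edge_cut ?Q X \<inter> T = {e'}" "edge_cut ?Q Y \<inter> T = {f'}"
      "edge_cut ?Q X \<inter> edge_cut ?Q Y = {}" "inj_on c (edge_cut ?Q X - T)" "inj_on c (edge_cut ?Q Y - T)"
      "card (edge_cut ?Q X) + card (edge_cut ?Q Y) \<le> n + 3"
      using Suc.IH[OF contract(1)] unfolding disjoint_rainbow_cuts_def by (elim exE conjE)
    have "?P X \<subseteq> verts H" "?P Y \<subseteq> verts H" by blast+
    moreover have "card (edge_cut ?Q X) + card (edge_cut ?Q Y) \<le> Suc n + 3" using XY(9) by simp
    ultimately show ?thesis using XY(3-8) unfolding disjoint_rainbow_cuts_def contract(2)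
      by (intro exI[of _ "?P X"] exI[of _ "?P Y"] exI[of _ e'] exI[of _ f'] conjI)
  qed
qed

section \<open>Bonds, circuits and splittings\<close>

text \<open>Going round the cycle from one end of \<open>e\<close> to the other without using
  \<open>e\<close> never changes sides, so \<open>e\<close> cannot cross either.\<close>

lemma cycle_meets_cut_twice:
  assumes "is_cycle G C"
  shows "C \<inter> edge_cut G X \<noteq> {e}"
proof
  assume single: "C \<inter> edge_cut G X = {e}"
  obtain vs es where es: "es \<noteq> []" "length vs = length es" "distinct es" "set es \<subseteq> edges G"
    "\<forall>i<length es. ends G (es ! i) = {vs ! i, vs ! (Suc i mod length es)}" "C = set es"
    using assms unfolding is_cycle_def by blast
  let ?L = "length es"
  have L: "0 < ?L" using es(1) by simp
  obtain k where k: "k < ?L" "es ! k = e" using single es(6) by (metis IntD1 in_set_conv_nth insertI1)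
  have cross: "(es ! i \<in> edge_cut G X) \<longleftrightarrow> (vs ! i \<in> X) \<noteq> (vs ! (Suc i mod ?L) \<in> X)" if "i < ?L" for i
    by (rule cut_iff) (use es(4,5) that in auto)
  have same: "(vs ! i \<in> X) = (vs ! (Suc i mod ?L) \<in> X)" if "i < ?L" "i \<noteq> k" for i
  proof -
    have "es ! i \<noteq> e" using that k es(3) by (metis nth_eq_iff_index_eq)
    moreover have "es ! i \<in> C" using that(1) es(6) by simp
    ultimately have "es ! i \<notin> edge_cut G X" using single by blast
    then show ?thesis using cross[OF that(1)] by simp
  qed
  \<comment> \<open>Starts just after position \<open>k\<close>; at most \<open>?L - 1\<close> steps
    are made, so the edge at \<open>k\<close> is never traversed.\<close>
  have "(vs ! ((Suc k + j) mod ?L) \<in> X) = (vs ! (Suc k mod ?L) \<in> X)" if "j < ?L" for j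
    using that
  proof (induction j)
    case (Suc j)
    let ?i = "(Suc k + j) mod ?L"
    have "?i < ?L" using L by simp
    moreover have "?i \<noteq> k"
    proof (cases "Suc k + j < ?L")
      case False
      then have "?i = Suc k + j - ?L" using k(1) Suc.prems by (simp add: mod_if)
      then show ?thesis using False Suc.prems by linarith
    qed simp
    ultimately have "(vs ! ?i \<in> X) = (vs ! (Suc ?i mod ?L) \<in> X)" by (rule same)
    moreover have "Suc ?i mod ?L = (Suc k + Suc j) mod ?L" by (simp add: mod_Suc_eq)
    ultimately show ?case using Suc by simp
  qed simp
  from this[of "?L - 1"] have "(vs ! k \<in> X) = (vs ! (Suc k mod ?L) \<in> X)" using L k(1) by simp
  moreover have "e \<in> edge_cut G X" using single by blast
  ultimately show False using cross[OF k(1)] k(2) by simp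
qed

text \<open>Simplicity is kept in the induction: on reaching a visited vertex again, the path is
  truncated there.\<close>

lemma simple_path_if_reachable:
  assumes "(x, y) \<in> {(x, y). \<exists>e\<in>F. ends G e = {x, y}}\<^sup>*"
  shows "\<exists>vs es. length vs = Suc (length es) \<and> distinct vs \<and> vs ! 0 = x \<and> vs ! length es = y \<and>
    set es \<subseteq> F \<and> (\<forall>i<length es. ends G (es ! i) = {vs ! i, vs ! Suc i})"
  using assms
proof (induction rule: rtrancl_induct)
  case base
  show ?case by (intro exI[of _ "[x]"] exI[of _ "[]"]) simp
next
  case (step y z)
  then obtain vs es where p: "length vs = Suc (length es)" "distinct vs" "vs ! 0 = x" "vs ! length es = y"
    "set es \<subseteq> F" "\<forall>i<length es. ends G (es ! i) = {vs ! i, vs ! Suc i}" by blast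
  obtain e where e: "e \<in> F" "ends G e = {y, z}" using step.hyps(2) by blast
  show ?case
  proof (cases "z \<in> set vs")
    case True
    then obtain k where k: "k < length vs" "vs ! k = z" by (auto simp: in_set_conv_nth)
    then have "k \<le> length es" using p(1) by simp
    moreover have "set (take k es) \<subseteq> F" using p(5) set_take_subset[of k es] by blast
    ultimately show ?thesis using p k
      by (intro exI[of _ "take (Suc k) vs"] exI[of _ "take k es"]) auto
  next
    case False
    have "ends G ((es @ [e]) ! i) = {(vs @ [z]) ! i, (vs @ [z]) ! Suc i}" if "i < Suc (length es)" for i
    proof (cases "i < length es")
      case True
      then show ?thesis using p(1,6) by (simp add: nth_append)
    next
      case False
      then have "i = length es" using that by simp
      then show ?thesis using p(1,4) e(2) by (simp add: nth_append)
    qed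
    then show ?thesis using p e False
      by (intro exI[of _ "vs @ [z]"] exI[of _ "es @ [e]"]) (simp add: nth_append)
  qed
qed

lemma cycle_if_reachable:
  assumes "graph G" "F \<subseteq> edges G" "e \<in> edges G" "e \<notin> F" "ends G e = {x, y}" "x \<noteq> y"
    and "(x, y) \<in> {(x, y). \<exists>e\<in>F. ends G e = {x, y}}\<^sup>*"
  shows "\<exists>C\<subseteq>insert e F. is_cycle G C"
proof -
  obtain vs es where p: "length vs = Suc (length es)" "distinct vs" "vs ! 0 = x" "vs ! length es = y"
    "set es \<subseteq> F" "\<forall>i<length es. ends G (es ! i) = {vs ! i, vs ! Suc i}"
    using simple_path_if_reachable[OF assms(7)] by blast
  let ?es = "es @ [e]"
  \<comment> \<open>Distinct vertices give distinct consecutive pairs; a swapped pair would need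
    \<open>i = Suc j\<close> and \<open>Suc i = j\<close>.\<close>
  have "distinct es"
  proof (rule distinct_conv_nth[THEN iffD2], intro allI impI)
    fix i j assume ij: "i < length es" "j < length es" "i \<noteq> j"
    show "es ! i \<noteq> es ! j"
    proof
      assume "es ! i = es ! j"
      then have "{vs ! i, vs ! Suc i} = {vs ! j, vs ! Suc j}" using p(6) ij by metis
      moreover have "vs ! i \<noteq> vs ! j" "vs ! Suc i \<noteq> vs ! Suc j"
        using p(1,2) ij by (simp_all add: nth_eq_iff_index_eq)
      ultimately have "vs ! i = vs ! Suc j" "vs ! Suc i = vs ! j" by (auto simp: doubleton_eq_iff)
      then have "i = Suc j" "Suc i = j" using p(1,2) ij by (simp_all add: nth_eq_iff_index_eq)
      then show False by simp
    qed
  qed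
  then have de: "distinct ?es" using p(5) assms(4) by auto
  have ends: "ends G (?es ! i) = {vs ! i, vs ! (Suc i mod length ?es)}" if "i < length ?es" for i
  proof (cases "i < length es")
    case True
    then show ?thesis using p(6) by (simp add: nth_append)
  next
    case False
    then have "i = length es" using that by simp
    then show ?thesis using p(3,4) assms(5) by (simp add: insert_commute)
  qed
  have sE: "set ?es \<subseteq> edges G" using p(5) assms(2,3) by auto
  have sV: "set vs \<subseteq> verts G"
  proof
    fix v assume "v \<in> set vs"
    then obtain i where i: "i < length ?es" "vs ! i = v" using p(1) by (auto simp: in_set_conv_nth)
    have "?es ! i \<in> edges G" using sE i(1) nth_mem by blast
    then have "ends G (?es ! i) \<subseteq> verts G" using assms(1) by (simp add: graph_def)
    then show "v \<in> verts G" using ends[OF i(1)] i(2) by auto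
  qed
  have "is_cycle G (set ?es)"
    unfolding is_cycle_def using p(1,2) de sE sV ends
    by (intro exI[of _ vs] exI[of _ ?es] conjI) auto
  moreover have "set ?es \<subseteq> insert e F" using p(5) by auto
  ultimately show ?thesis by blast
qed

lemma loop_is_cycle:
  assumes "graph G" "e \<in> edges G" "ends G e = {x}"
  shows "is_cycle G {e}"
proof -
  have "x \<in> verts G" using assms by (auto simp: graph_def)
  then show ?thesis unfolding is_cycle_def using assms
    by (intro exI[of _ "[x]"] exI[of _ "[e]"]) auto
qed

section \<open>Circuits of the cocycle matroid in terms of cuts\<close>

lemma indep_cycle_matroid:
  "indep (cycle_matroid G) F \<longleftrightarrow> F \<subseteq> edges G \<and> \<not> (\<exists>C. is_cycle G C \<and> C \<subseteq> F)"
  by (simp add: cycle_matroid_def)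

lemma indep_cocycle_matroid:
  "indep (cocycle_matroid G) I \<longleftrightarrow> I \<subseteq> edges G \<and> (\<exists>B. basis (cycle_matroid G) B \<and> I \<inter> B = {})"
  by (simp add: cocycle_matroid_def dual_def cycle_matroid_def)

lemma ground_cocycle_matroid [simp]: "ground (cocycle_matroid G) = edges G"
  by (simp add: cocycle_matroid_def dual_def cycle_matroid_def)

text \<open>A basis missing the cut could not be extended by a cut edge \<open>e\<close> without
  closing a cycle, and that cycle would meet the cut in \<open>e\<close> alone.\<close>

lemma cut_dependent:
  assumes "edge_cut G X \<noteq> {}"
  shows "\<not> indep (cocycle_matroid G) (edge_cut G X)"
proof
  assume "indep (cocycle_matroid G) (edge_cut G X)"
  then obtain B where B: "basis (cycle_matroid G) B" "edge_cut G X \<inter> B = {}"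
    unfolding indep_cocycle_matroid by blast
  obtain e where e: "e \<in> edge_cut G X" using assms by blast
  have eE: "e \<in> edges G" using e cut_subset[of G X] by blast
  have Bi: "B \<subseteq> edges G" "\<not> (\<exists>C. is_cycle G C \<and> C \<subseteq> B)"
    using B(1) unfolding basis_def indep_cycle_matroid by blast+
  have "insert e B \<noteq> B" using e B(2) by blast
  then have "\<not> indep (cycle_matroid G) (insert e B)"
    using B(1) unfolding basis_def by (metis subset_insertI)
  then obtain C where C: "is_cycle G C" "C \<subseteq> insert e B"
    using Bi(1) eE unfolding indep_cycle_matroid by blast
  have "e \<in> C" using C Bi(2) by blast
  then have "C \<inter> edge_cut G X = {e}" using C(2) B(2) e by blast
  then show False using cycle_meets_cut_twice[OF C(1)] by blast
qed

text \<open>The condition says that deleting \<open>D\<close> leaves the graph connected, so a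
  maximal acyclic set outside \<open>D\<close> is a spanning tree.\<close>

lemma basis_avoiding:
  assumes g: "graph G" and D: "\<And>X. X \<subseteq> verts G \<Longrightarrow> edge_cut G X \<subseteq> D \<Longrightarrow> X = {} \<or> X = verts G"
  shows "\<exists>B. basis (cycle_matroid G) B \<and> B \<inter> D = {}"
proof -
  let ?acyc = "\<lambda>F. F \<subseteq> edges G - D \<and> \<not> (\<exists>C. is_cycle G C \<and> C \<subseteq> F)"
  have fin: "finite (edges G)" using g by (simp add: graph_def)
  have "finite {F. ?acyc F}"
    by (rule finite_subset[of _ "Pow (edges G)"]) (use fin in auto)
  moreover have "?acyc {}" unfolding is_cycle_def by auto
  then have "{F. ?acyc F} \<noteq> {}" by blast
  ultimately have "\<exists>B\<in>{F. ?acyc F}. \<forall>F\<in>{F. ?acyc F}. B \<subseteq> F \<longrightarrow> B = F"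
    by (rule finite_has_maximal)
  then obtain B where B: "B \<in> {F. ?acyc F}" "\<forall>F\<in>{F. ?acyc F}. B \<subseteq> F \<longrightarrow> B = F"
    by (elim bexE)
  have BE: "B \<subseteq> edges G" "B \<inter> D = {}" "\<not> (\<exists>C. is_cycle G C \<and> C \<subseteq> B)" using B(1) by auto
  let ?r = "{(x, y). \<exists>e\<in>B. ends G e = {x, y}}"
  have spanning: "(x, y) \<in> ?r\<^sup>*" if xy: "x \<in> verts G" "y \<in> verts G" for x y
  proof -
    \<comment> \<open>The component of \<open>x\<close> in \<open>B\<close>. An edge outside
      \<open>D\<close> leaving it could be added to \<open>B\<close> without creating a cycle, so
      its cut lies in \<open>D\<close>.\<close>
    define X where "X = {z\<in>verts G. (x, z) \<in> ?r\<^sup>*}"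
    have noB: "edge_cut G X \<inter> B = {}"
    proof (rule ccontr)
      assume "edge_cut G X \<inter> B \<noteq> {}"
      then obtain h where h: "h \<in> edge_cut G X" "h \<in> B" by blast
      have hE: "h \<in> edges G" using h(2) BE(1) by blast
      obtain p q where pq: "ends G h = {p, q}" "p \<in> verts G" "q \<in> verts G" by (rule graph_ends[OF g hE])
      have "(p, q) \<in> ?r" "(q, p) \<in> ?r" using pq(1) h(2) by (auto simp: insert_commute)
      then have "p \<in> X \<longleftrightarrow> q \<in> X" using pq(2,3) by (auto simp: X_def intro: rtrancl_into_rtrancl)
      then show False using h(1) cut_iff[OF hE pq(1)] by blast
    qed
    have "edge_cut G X \<subseteq> D"
    proof
      fix h assume h: "h \<in> edge_cut G X"
      show "h \<in> D"
      proof (rule ccontr)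
        assume "h \<notin> D"
        have hB: "h \<notin> B" using noB h by blast
        have "\<not> (\<exists>C. is_cycle G C \<and> C \<subseteq> insert h B)"
        proof
          assume "\<exists>C. is_cycle G C \<and> C \<subseteq> insert h B"
          then obtain C where C: "is_cycle G C" "C \<subseteq> insert h B" by blast
          then have "h \<in> C" using BE(3) by blast
          then have "C \<inter> edge_cut G X = {h}" using C(2) noB h by blast
          then show False using cycle_meets_cut_twice[OF C(1)] by blast
        qed
        moreover have "insert h B \<subseteq> edges G - D" using h cut_subset[of G X] \<open>h \<notin> D\<close> BE(1,2) by blast
        ultimately have "insert h B \<in> {F. ?acyc F}" by simp
        then have "B = insert h B" using bspec[OF B(2)] by blast
        then show False using hB by blast
      qed
    qed
    moreover have "X \<subseteq> verts G" by (auto simp: X_def)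
    ultimately have "X = {} \<or> X = verts G" by (intro D)
    moreover have "x \<in> X" using xy by (simp add: X_def)
    ultimately have "y \<in> X" using xy by blast
    then show ?thesis by (simp add: X_def)
  qed
  have "basis (cycle_matroid G) B"
    unfolding basis_def
  proof (intro conjI allI impI)
    show "indep (cycle_matroid G) B" using BE by (simp add: indep_cycle_matroid)
    fix I assume I: "indep (cycle_matroid G) I \<and> B \<subseteq> I"
    show "I = B"
    proof (rule ccontr)
      assume "I \<noteq> B"
      then obtain e where e: "e \<in> I" "e \<notin> B" using I by blast
      have noC: "\<not> (\<exists>C. is_cycle G C \<and> C \<subseteq> I)" and eE: "e \<in> edges G"
        using I e unfolding indep_cycle_matroid by blast+
      obtain x y where xy: "ends G e = {x, y}" "x \<in> verts G" "y \<in> verts G" by (rule graph_ends[OF g eE])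
      have "\<exists>C\<subseteq>insert e B. is_cycle G C"
      proof (cases "x = y")
        case True
        then have "is_cycle G {e}" using loop_is_cycle[OF g eE] xy(1) by simp
        then show ?thesis by blast
      next
        case False
        then show ?thesis using cycle_if_reachable[OF g BE(1) eE e(2) xy(1)] spanning[OF xy(2,3)] by blast
      qed
      then show False using noC I e(1) by blast
    qed
  qed
  then show ?thesis using BE(2) by blast
qed

lemma dependent_contains_circuit:
  assumes "finite S" "S \<subseteq> ground M" "\<not> indep M S"
  shows "\<exists>C\<subseteq>S. circuit M C"
  using assms
proof (induction S rule: finite_psubset_induct)
  case (psubset S)
  show ?case
  proof (cases "\<forall>D. D \<subset> S \<longrightarrow> indep M D")
    case True
    then show ?thesis using psubset.prems unfolding circuit_def by blast
  next
    case False
    then obtain D where D: "D \<subset> S" "\<not> indep M D" by blast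
    then obtain C where "C \<subseteq> D" "circuit M C" using psubset.IH[of D] psubset.prems(1) by blast
    then show ?thesis using D(1) by blast
  qed
qed

text \<open>Connectedness stated by cuts, which passes through splittings without following
  paths.\<close>

definition cut_connected :: "('v, 'e) mgraph \<Rightarrow> bool" where
  "cut_connected G \<longleftrightarrow> (\<forall>X\<subseteq>verts G. edge_cut G X = {} \<longrightarrow> X = {} \<or> X = verts G)"

lemma cut_connected_if_connected:
  assumes "connected_graph G"
  shows "cut_connected G"
  unfolding cut_connected_def
proof (intro allI impI, rule ccontr)
  fix X assume X: "X \<subseteq> verts G" "edge_cut G X = {}" "\<not> (X = {} \<or> X = verts G)"
  then obtain x w where xw: "x \<in> X" "w \<in> verts G" "w \<notin> X" by blast
  have "(x, w) \<in> {(x, y). \<exists>e\<in>edges G. ends G e = {x, y}}\<^sup>*"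
    using assms xw X(1) unfolding connected_graph_def by blast
  then have "w \<in> X"
  proof (induction rule: rtrancl_induct)
    case (step y z)
    then obtain e where e: "e \<in> edges G" "ends G e = {y, z}" by blast
    then have "e \<notin> edge_cut G X" using X(2) by simp
    then show ?case using cut_iff[OF e] step.IH by simp
  qed (rule xw(1))
  then show False using xw(3) by simp
qed

text \<open>Contracting \<open>f\<close> undoes the splitting, so a cut of \<open>H'\<close>
  avoiding \<open>f\<close> comes from a cut of \<open>H\<close> with the same edges. The trivial
  sides are tracked to transfer both connectedness and the cut conditions.\<close>

lemma splitting_cuts:
  assumes sp: "splitting H v f H'" and g: "graph H"
  shows "graph H'" "card (verts H') = Suc (card (verts H))"
    "edges H' = insert f (edges H)" "f \<notin> edges H"
    and "X' \<subseteq> verts H' \<Longrightarrow> f \<notin> edge_cut H' X' \<Longrightarrow>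
      \<exists>X\<subseteq>verts H. edge_cut H X = edge_cut H' X' \<and> (X = {} \<longleftrightarrow> X' = {}) \<and> (X = verts H \<longleftrightarrow> X' = verts H')"
proof -
  obtain E1 E2 v1 v2 where vf: "v \<in> verts H" "f \<notin> edges H"
    and E: "E1 \<inter> E2 = {}" "E1 \<union> E2 = {e\<in>edges H. v \<in> ends H e}"
    and new: "v1 \<notin> verts H" "v2 \<notin> verts H" "v1 \<noteq> v2"
    and V': "verts H' = (verts H - {v}) \<union> {v1, v2}" and E': "edges H' = insert f (edges H)"
    and ends_f: "ends H' f = {v1, v2}"
    and ends1: "\<forall>e\<in>E1. ends H' e = (ends H e - {v}) \<union> {v1}"
    and ends2: "\<forall>e\<in>E2. ends H' e = (ends H e - {v}) \<union> {v2}"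
    and ends3: "\<forall>e\<in>edges H - (E1 \<union> E2). ends H' e = ends H e"
    using sp unfolding splitting_def by (elim conjE exE)
  show "edges H' = insert f (edges H)" "f \<notin> edges H" by (rule E' vf(2))+
  have fin: "finite (verts H)" using g by (simp add: graph_def)
  have "card (verts H - {v}) = card (verts H) - 1" "0 < card (verts H)"
    using vf(1) fin by (auto simp: card_gt_0_iff)
  moreover have "card (verts H') = card (verts H - {v}) + card {v1, v2}"
    unfolding V' by (rule card_Un_disjoint) (use new fin in auto)
  ultimately show "card (verts H') = Suc (card (verts H))" using new(3) by simp
  define \<pi> where "\<pi> = id(v1 := v, v2 := v)"
  have \<pi>_old: "\<pi> z = z" if "z \<in> verts H" for z using that new by (auto simp: \<pi>_def)
  have \<pi>_old_image: "\<pi> ` S = S" if "S \<subseteq> verts H" for S using that \<pi>_old by (force simp: image_iff)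
  have sub: "ends H e \<subseteq> verts H" if "e \<in> edges H" for e using that g by (simp add: graph_def)
  have ends_cases: "ends H' e = ends H e \<and> v \<notin> ends H e \<or> v \<in> ends H e \<and>
      (ends H' e = insert v1 (ends H e - {v}) \<or> ends H' e = insert v2 (ends H e - {v}))"
    if "e \<in> edges H" for e
  proof -
    consider "e \<in> E1" | "e \<in> E2" | "e \<notin> E1 \<union> E2" by blast
    then show ?thesis
    proof cases
      case 1
      then show ?thesis using ends1 E(2) by auto
    next
      case 2
      then show ?thesis using ends2 E(2) by auto
    next
      case 3
      then have "v \<notin> ends H e" using E(2) that by blast
      then show ?thesis using ends3 3 that by blast
    qed
  qed
  have \<pi>_ends: "ends H e = \<pi> ` ends H' e" if e: "e \<in> edges H" for e
  proof -
    have same: "\<pi> ` (ends H e - {v}) = ends H e - {v}" "\<pi> ` ends H e = ends H e"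
      using sub[OF e] by (intro \<pi>_old_image; blast)+
    have new: "\<pi> v1 = v" "\<pi> v2 = v" by (simp_all add: \<pi>_def)
    from ends_cases[OF e] show ?thesis
    proof (elim disjE conjE)
      assume "ends H' e = ends H e"
      then show ?thesis by (simp only: same)
    next
      assume "v \<in> ends H e" "ends H' e = insert v1 (ends H e - {v})"
      then show ?thesis by (simp only: image_insert same new insert_Diff)
    next
      assume "v \<in> ends H e" "ends H' e = insert v2 (ends H e - {v})"
      then show ?thesis by (simp only: image_insert same new insert_Diff)
    qed
  qed
  show g': "graph H'"
    unfolding graph_def
  proof (intro conjI ballI)
    show "finite (verts H')" using fin V' by simp
    show "finite (edges H')" using g E' by (simp add: graph_def)
    fix e assume e: "e \<in> edges H'"
    have "ends H' e \<subseteq> verts H' \<and> card (ends H' e) \<in> {1, 2}"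
    proof (cases "e = f")
      case True
      then show ?thesis using ends_f V' new(3) by simp
    next
      case False
      then have eH: "e \<in> edges H" using e E' by simp
      have fe: "finite (ends H e)" using sub[OF eH] fin finite_subset by blast
      have "card (ends H e) \<in> {1, 2}" using g eH by (simp add: graph_def)
      moreover have "v1 \<notin> ends H e" "v2 \<notin> ends H e" using sub[OF eH] new by blast+
      ultimately show ?thesis using ends_cases[OF eH] sub[OF eH] V' fe
        by (auto simp: card_gt_0_iff)
    qed
    then show "ends H' e \<subseteq> verts H'" "card (ends H' e) \<in> {1, 2}" by simp_all
  qed
  have \<pi>V: "\<pi> ` verts H' = verts H"
  proof -
    have "\<pi> ` (verts H - {v}) = verts H - {v}" by (rule \<pi>_old_image) blast
    moreover have "\<pi> v1 = v" "\<pi> v2 = v" by (simp_all add: \<pi>_def)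
    ultimately show ?thesis unfolding V' using vf(1) by auto
  qed
  let ?Q = "quotient_graph H' \<pi> (edges H)"
  \<comment> \<open>The quotient may differ from \<open>H\<close> as a record, namely in
    \<open>ends\<close> outside the edges; cuts do not see this.\<close>
  have cut_eq: "edge_cut ?Q X = edge_cut H X" for X using \<pi>_ends by (auto simp: edge_cut_def)
  have cutH: "edge_cut H X = edge_cut H' {z\<in>verts H'. \<pi> z \<in> X}" for X
    unfolding cut_eq[symmetric]
  proof (rule cut_quotient[OF g'])
    show "edges H \<subseteq> edges H'" using E' by blast
    fix e x y assume e: "e \<in> edges H' - edges H" and xy: "x \<in> ends H' e" "y \<in> ends H' e"
    then have "e = f" using E' by blast
    then show "\<pi> x = \<pi> y" using xy ends_f by (auto simp: \<pi>_def)
  qed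
  show "\<exists>X\<subseteq>verts H. edge_cut H X = edge_cut H' X' \<and> (X = {} \<longleftrightarrow> X' = {}) \<and> (X = verts H \<longleftrightarrow> X' = verts H')"
    if X': "X' \<subseteq> verts H'" "f \<notin> edge_cut H' X'"
  proof -
    have f': "f \<in> edges H'" using E' by simp
    have both: "v1 \<in> X' \<longleftrightarrow> v2 \<in> X'" using cut_iff[OF f' ends_f] X'(2) by simp
    have pre: "{z\<in>verts H'. \<pi> z \<in> \<pi> ` X'} = X'"
    proof
      show "{z\<in>verts H'. \<pi> z \<in> \<pi> ` X'} \<subseteq> X'"
      proof
        fix z assume "z \<in> {z\<in>verts H'. \<pi> z \<in> \<pi> ` X'}"
        then obtain z' where z: "z \<in> verts H'" "z' \<in> X'" "\<pi> z = \<pi> z'" by blast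
        have "z' \<in> verts H'" using z(2) X'(1) by blast
        have "z \<noteq> v" "z' \<noteq> v" using z(1) \<open>z' \<in> verts H'\<close> V' new vf(1) by auto
        then have "z = z' \<or> z \<in> {v1, v2} \<and> z' \<in> {v1, v2}"
          using z(3) by (auto simp: \<pi>_def split: if_splits)
        then show "z \<in> X'" using z(2) both by auto
      qed
    qed (use X'(1) in blast)
    have "\<pi> ` X' \<subseteq> verts H" using X'(1) \<pi>V by blast
    moreover have "edge_cut H (\<pi> ` X') = edge_cut H' X'" unfolding cutH pre ..
    moreover have "\<pi> ` X' = verts H \<longleftrightarrow> X' = verts H'"
    proof
      assume "\<pi> ` X' = verts H"
      then have "{z\<in>verts H'. \<pi> z \<in> \<pi> ` X'} = verts H'" using \<pi>V by blast
      then show "X' = verts H'" unfolding pre .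
    qed (use \<pi>V in simp)
    ultimately show ?thesis by (intro exI[of _ "\<pi> ` X'"]) simp
  qed
qed

lemma splitting_cut_connected:
  assumes "splitting H v f H'" "graph H" "cut_connected H"
  shows "cut_connected H'"
  unfolding cut_connected_def
proof (intro allI impI)
  fix X' assume X': "X' \<subseteq> verts H'" "edge_cut H' X' = {}"
  then obtain X where "X \<subseteq> verts H" "edge_cut H X = {}" "X = {} \<longleftrightarrow> X' = {}" "X = verts H \<longleftrightarrow> X' = verts H'"
    using splitting_cuts(5)[OF assms(1,2) X'(1)] by auto
  then show "X' = {} \<or> X' = verts H'" using assms(3) unfolding cut_connected_def by blast
qed

text \<open>Dependence of \<open>T\<close> yields a proper side whose cut lies in \<open>T\<close>;
  minimality forces every such cut to be all of \<open>T\<close>. Two sides with the same cut have a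
  symmetric difference with empty cut, so they agree or are complementary.\<close>

lemma bond_is_cut:
  assumes g: "graph G" and conn: "cut_connected G" and T: "circuit (cocycle_matroid G) T"
  obtains A where "A \<subseteq> verts G" "edge_cut G A = T"
    "\<forall>X. X \<subseteq> verts G \<longrightarrow> edge_cut G X \<subseteq> T \<longrightarrow> X \<in> {{}, verts G, A, verts G - A}"
proof -
  have TE: "T \<subseteq> edges G" and dep: "\<not> indep (cocycle_matroid G) T"
    and min: "\<And>D. D \<subset> T \<Longrightarrow> indep (cocycle_matroid G) D"
    using T unfolding circuit_def by auto
  have "\<not> (\<exists>B. basis (cycle_matroid G) B \<and> B \<inter> T = {})"
    using dep TE unfolding indep_cocycle_matroid by blast
  then obtain A where A: "A \<subseteq> verts G" "edge_cut G A \<subseteq> T" "A \<noteq> {}" "A \<noteq> verts G"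
    using basis_avoiding[OF g, of T] by blast
  have all: "edge_cut G X = T" if "X \<subseteq> verts G" "edge_cut G X \<subseteq> T" "X \<noteq> {}" "X \<noteq> verts G" for X
  proof -
    have "edge_cut G X \<noteq> {}" using conn that unfolding cut_connected_def by blast
    then have "\<not> indep (cocycle_matroid G) (edge_cut G X)" by (rule cut_dependent)
    then show ?thesis using min[of "edge_cut G X"] that(2) by blast
  qed
  have "X \<in> {{}, verts G, A, verts G - A}" if X: "X \<subseteq> verts G" "edge_cut G X \<subseteq> T" for X
  proof (cases "X = {} \<or> X = verts G")
    case False
    then have "edge_cut G X = edge_cut G A" using all[OF X] all[OF A] by simp
    then have "e \<notin> edge_cut G ((X - A) \<union> (A - X))" for e
      using cut_symdiff_iff[OF g, of e X A] cut_subset[of G "(X - A) \<union> (A - X)"] by blast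
    then have "edge_cut G ((X - A) \<union> (A - X)) = {}" by blast
    moreover have "(X - A) \<union> (A - X) \<subseteq> verts G" using X(1) A(1) by blast
    ultimately have "(X - A) \<union> (A - X) = {} \<or> (X - A) \<union> (A - X) = verts G"
      using conn unfolding cut_connected_def by blast
    then show ?thesis
    proof
      assume "(X - A) \<union> (A - X) = {}"
      then have "X = A" by blast
      then show ?thesis by simp
    next
      assume "(X - A) \<union> (A - X) = verts G"
      then have "X = verts G - A" using X(1) A(1) by blast
      then show ?thesis by simp
    qed
  qed auto
  then have "\<forall>X. X \<subseteq> verts G \<longrightarrow> edge_cut G X \<subseteq> T \<longrightarrow> X \<in> {{}, verts G, A, verts G - A}"
    by (intro allI impI)
  then show thesis by (rule that[OF A(1) all[OF A]])
qed

text \<open>A nonempty cut contains a circuit of the cocycle matroid, which has at least three edges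
  and repeats a colour.\<close>

lemma cut_in_simple_achromatic:
  assumes g: "graph G" and conn: "cut_connected G" and simple: "simple_matroid (cocycle_matroid G)"
    and achrom: "circuit_achromatic (cocycle_matroid G) c"
    and X: "X \<subseteq> verts G" "X \<noteq> {}" "X \<noteq> verts G"
  shows "3 \<le> card (edge_cut G X)" "\<not> inj_on c (edge_cut G X)"
proof -
  have fin: "finite (edge_cut G X)" by (rule finite_cut[OF g])
  have "edge_cut G X \<noteq> {}" using conn X unfolding cut_connected_def by blast
  then have "\<not> indep (cocycle_matroid G) (edge_cut G X)" by (rule cut_dependent)
  moreover have "edge_cut G X \<subseteq> ground (cocycle_matroid G)" using cut_subset[of G X] by simp
  ultimately obtain C where C: "C \<subseteq> edge_cut G X" "circuit (cocycle_matroid G) C"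
    using dependent_contains_circuit[OF fin] by blast
  \<comment> \<open>A basis exists, so the empty set is independent in the cocycle matroid and is
    not the circuit \<open>C\<close>.\<close>
  have "\<exists>B. basis (cycle_matroid G) B \<and> B \<inter> {} = {}"
    by (rule basis_avoiding[OF g]) (use conn in \<open>simp add: cut_connected_def\<close>)
  then have "indep (cocycle_matroid G) {}" unfolding indep_cocycle_matroid by blast
  then have "C \<noteq> {}" using C(2) unfolding circuit_def by blast
  moreover have finC: "finite C" using C(1) fin finite_subset by blast
  ultimately have "card C \<noteq> 0" by simp
  moreover have "card C \<notin> {1, 2}" using simple C(2) unfolding simple_matroid_def by blast
  moreover have "card C \<le> card (edge_cut G X)" by (rule card_mono[OF fin C(1)])
  ultimately show "3 \<le> card (edge_cut G X)" by simp
  show "\<not> inj_on c (edge_cut G X)"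
  proof
    assume "inj_on c (edge_cut G X)"
    then have "rainbow c C" unfolding rainbow_def using C(1) by (rule inj_on_subset)
    then show False using achrom C(2) unfolding circuit_achromatic_def by blast
  qed
qed

section \<open>Return to cocycles, the extended colouring and the rank\<close>

lemma cut_cocycle:
  assumes "X \<subseteq> verts G" "e \<in> edge_cut G X"
  shows "cocycle G (edge_cut G X)"
  unfolding cocycle_def using assms by (auto simp: edge_cut_def)

text \<open>The only edge of \<open>T\<close> in \<open>S\<close> receives n + 1, a colour larger
  than all those on the rest of \<open>S\<close>.\<close>

lemma rainbow_recoloured:
  fixes c :: "'e \<Rightarrow> nat"
  assumes "S \<inter> T = {e}" "T = {e1, e2, e3}" "inj_on c (S - T)" "\<And>f. f \<in> S - T \<Longrightarrow> c f \<le> n"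
  shows "rainbow (c(e1 := n + 1, e2 := n + 1, e3 := n + 1)) S"
proof -
  define c' where "c' = c(e1 := n + 1, e2 := n + 1, e3 := n + 1)"
  have S: "S = insert e (S - T)" and e: "e \<in> T" using assms(1) by blast+
  have old: "c' f = c f" if "f \<in> S - T" for f using that assms(2) by (auto simp: c'_def)
  have "inj_on c' (S - T)" using inj_on_cong[of "S - T" c' c] old assms(3) by blast
  moreover have "c' e \<notin> c' ` (S - T)"
  proof
    assume "c' e \<in> c' ` (S - T)"
    then obtain f where f: "f \<in> S - T" "c' e = c' f" by blast
    moreover have "c' e = n + 1" using e assms(2) by (auto simp: c'_def)
    ultimately show False using old[OF f(1)] assms(4)[OF f(1)] by simp
  qed
  ultimately have "inj_on c' (insert e (S - T))" using e by simp
  then show ?thesis unfolding rainbow_def c'_def[symmetric] using S by simp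
qed

theorem theorem5:
  fixes G G1 G2 G3 :: "('v, 'e) mgraph"
    and c :: "'e \<Rightarrow> nat"
    and n :: nat
    and v1 v2 v3 :: 'v
    and e1 e2 e3 :: 'e
  assumes "graph G"
    and "connected_graph G"
    and "card (verts G) = n"
    and "simple_matroid (cocycle_matroid G)"
    and "int (card (ground (cocycle_matroid G))) = 2 * (int (rank (cocycle_matroid G)) - 1)"
    and "c ` edges G \<subseteq> {1..n}"
    and "\<forall>i\<in>{1..n}. card {e\<in>edges G. c e = i} = 2"
    and "circuit_achromatic (cocycle_matroid G) c"
    and "splitting G v1 e1 G1"
    and "splitting G1 v2 e2 G2"
    and "splitting G2 v3 e3 G3"
    and "circuit (cocycle_matroid G3) {e1, e2, e3}"
    and "indep (cycle_matroid G3) {e1, e2, e3}"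
  shows "\<exists>f1 f2 f3 C1 C2. {f1, f2, f3} = {e1, e2, e3} \<and> distinct [f1, f2, f3] \<and>
           cocycle G3 C1 \<and> cocycle G3 C2 \<and> C1 \<inter> C2 = {} \<and>
           rainbow (c(e1 := n + 1, e2 := n + 1, e3 := n + 1)) C1 \<and>
           rainbow (c(e1 := n + 1, e2 := n + 1, e3 := n + 1)) C2 \<and>
           f1 \<in> C1 \<and> f2 \<in> C2 \<and>
           card C1 + card C2 \<le> rank (cocycle_matroid G) + 2 \<and>
           rank (cocycle_matroid G) + 2 = n + 3"
proof -
  let ?T = "{e1, e2, e3}"
  note s1 = splitting_cuts[OF assms(9,1)]
  note s2 = splitting_cuts[OF assms(10) s1(1)]
  note s3 = splitting_cuts[OF assms(11) s2(1)]
  have conn: "cut_connected G" by (rule cut_connected_if_connected[OF assms(2)])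
  have conn3: "cut_connected G3"
    by (rule splitting_cut_connected[OF assms(11) s2(1) splitting_cut_connected[OF assms(10) s1(1)
          splitting_cut_connected[OF assms(9,1) conn]]])
  have E3: "edges G3 = edges G \<union> ?T" using s1(3) s2(3) s3(3) by auto
  have ne: "e1 \<noteq> e2" "e1 \<noteq> e3" "e2 \<noteq> e3" using s1(3) s2(3,4) s3(4) by auto
  have disjE: "edges G \<inter> ?T = {}" using s1(3,4) s2(3,4) s3(4) by auto
  have E0: "edges G3 - ?T = edges G" using E3 disjE by blast
  have fin: "finite (edges G)" using assms(1) by (simp add: graph_def)
  have img: "c ` edges G = {1..n}"
  proof
    show "{1..n} \<subseteq> c ` edges G"
    proof
      fix i assume "i \<in> {1..n}"
      then have "card {e\<in>edges G. c e = i} = 2" using assms(7) by blast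
      then have "{e\<in>edges G. c e = i} \<noteq> {}" by (metis card.empty zero_neq_numeral)
      then show "i \<in> c ` edges G" by blast
    qed
  qed (rule assms(6))
  have cls: "card {f\<in>edges G. c f = c e} = 2" if "e \<in> edges G" for e
    using assms(6,7) that by blast
  have "card (edges G) = (\<Sum>k\<in>c ` edges G. card {e\<in>edges G. c e = k})"
    using sum.image_gen[OF fin, of "\<lambda>_. 1::nat" c] by simp
  also have "\<dots> = (\<Sum>k\<in>{1..n}. 2)" unfolding img by (rule sum.cong[OF refl]) (use assms(7) in blast)
  finally have "card (edges G) = 2 * n" by simp
  \<comment> \<open>The rank is read off from 2n = 2(r - 1), with no spanning tree to be
    counted.\<close>
  then have rank: "rank (cocycle_matroid G) = n + 1" using assms(5) by simp
  obtain A where A: "A \<subseteq> verts G3" "edge_cut G3 A = ?T"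
    "\<forall>X. X \<subseteq> verts G3 \<longrightarrow> edge_cut G3 X \<subseteq> ?T \<longrightarrow> X \<in> {{}, verts G3, A, verts G3 - A}"
    by (rule bond_is_cut[OF s3(1) conn3 assms(12)])
  have "bond_split G3 ?T A c n"
  proof
    show "graph G3" by (rule s3(1))
    show "?T \<subseteq> edges G3" using E3 by blast
    show "card ?T = 3" using ne by simp
    show "card (verts G3) = n + 3" using s1(2) s2(2) s3(2) assms(3) by simp
    show "A \<subseteq> verts G3" "edge_cut G3 A = ?T" by (rule A)+
    show "X \<in> {{}, verts G3, A, verts G3 - A}" if "X \<subseteq> verts G3" "edge_cut G3 X \<subseteq> ?T" for X
      using A(3) that by blast
    show "card (c ` (edges G3 - ?T)) = n" unfolding E0 img by simp
    show "card {f\<in>edges G3 - ?T. c f = c e} = 2" if "e \<in> edges G3 - ?T" for e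
      using cls that unfolding E0 .
    show "3 \<le> card (edge_cut G3 X) \<and> \<not> inj_on c (edge_cut G3 X)"
      if X: "X \<subseteq> verts G3" "X \<noteq> {}" "X \<noteq> verts G3" "edge_cut G3 X \<inter> ?T = {}" for X
    proof -
      \<comment> \<open>The splittings are undone in reverse order, each step requiring that its new
        edge is not in the cut.\<close>
      have "e3 \<notin> edge_cut G3 X" using X(4) by blast
      then obtain X2 where X2: "X2 \<subseteq> verts G2" "edge_cut G2 X2 = edge_cut G3 X"
        "X2 \<noteq> {}" "X2 \<noteq> verts G2" using s3(5)[OF X(1)] X(2,3) by auto
      then have "e2 \<notin> edge_cut G2 X2" using X(4) by blast
      then obtain X1 where X1: "X1 \<subseteq> verts G1" "edge_cut G1 X1 = edge_cut G3 X"
        "X1 \<noteq> {}" "X1 \<noteq> verts G1" using s2(5)[OF X2(1)] X2(2-4) by auto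
      then have "e1 \<notin> edge_cut G1 X1" using X(4) by blast
      then obtain X0 where X0: "X0 \<subseteq> verts G" "edge_cut G X0 = edge_cut G3 X"
        "X0 \<noteq> {}" "X0 \<noteq> verts G" using s1(5)[OF X1(1)] X1(2-4) by auto
      show ?thesis
        using cut_in_simple_achromatic[OF assms(1) conn assms(4,8) X0(1,3,4)] unfolding X0(2) by blast
    qed
  qed
  then have "disjoint_rainbow_cuts G3 ?T c n" by (rule bond_split_conclusion)
  then obtain X Y f1 f2 where XY: "X \<subseteq> verts G3" "Y \<subseteq> verts G3" "f1 \<noteq> f2"
    "edge_cut G3 X \<inter> ?T = {f1}" "edge_cut G3 Y \<inter> ?T = {f2}" "edge_cut G3 X \<inter> edge_cut G3 Y = {}"
    "inj_on c (edge_cut G3 X - ?T)" "inj_on c (edge_cut G3 Y - ?T)"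
    "card (edge_cut G3 X) + card (edge_cut G3 Y) \<le> n + 3"
    unfolding disjoint_rainbow_cuts_def by (elim exE conjE)
  have f: "f1 \<in> edge_cut G3 X" "f2 \<in> edge_cut G3 Y" "f1 \<in> ?T" "f2 \<in> ?T" using XY(4,5) by blast+
  obtain f3 where f3: "{f1, f2, f3} = ?T" "distinct [f1, f2, f3]"
  proof -
    have "card (?T - {f1, f2}) = 1" using f(3,4) XY(3) ne by (simp add: card_Diff_subset)
    then obtain f3 where "?T - {f1, f2} = {f3}" by (auto simp: card_1_singleton_iff)
    then have "{f1, f2, f3} = ?T" "f3 \<notin> {f1, f2}" using f(3,4) by blast+
    then show thesis using XY(3) that[of f3] by auto
  qed
  have bounded: "c h \<le> n" if "h \<in> edge_cut G3 Z - ?T" for h Z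
  proof -
    have "h \<in> edges G" using that cut_subset[of G3 Z] E0 by blast
    then show ?thesis using assms(6) by auto
  qed
  have "cocycle G3 (edge_cut G3 X)" "cocycle G3 (edge_cut G3 Y)"
    by (rule cut_cocycle[OF XY(1) f(1)], rule cut_cocycle[OF XY(2) f(2)])
  moreover have "rainbow (c(e1 := n + 1, e2 := n + 1, e3 := n + 1)) (edge_cut G3 X)"
    by (rule rainbow_recoloured[OF XY(4) refl XY(7) bounded])
  moreover have "rainbow (c(e1 := n + 1, e2 := n + 1, e3 := n + 1)) (edge_cut G3 Y)"
    by (rule rainbow_recoloured[OF XY(5) refl XY(8) bounded])
  moreover have "card (edge_cut G3 X) + card (edge_cut G3 Y) \<le> rank (cocycle_matroid G) + 2"
    "rank (cocycle_matroid G) + 2 = n + 3" using XY(9) rank by simp_all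
  ultimately show ?thesis using f3 f(1,2) XY(6)
    by (intro exI[of _ f1] exI[of _ f2] exI[of _ f3] exI[of _ "edge_cut G3 X"]
        exI[of _ "edge_cut G3 Y"] conjI)
qed

end
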